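(* Consider the system $x_{k+1}=A_kx_k+B_ku_k+w_k$, $y_k=C_kx_k+v_k$ with the Kalman filter based estimator $\hat x_{k+1}=A_k\hat x_k+B_ku_k+K_k(y_k-C_k\hat x_k)$, as described in the context. Consider a function $h:\mathbb{R}^n\to\mathbb{R}$ satisfying: (i) $h$ is twice continuously differentiable; (ii) there is $\lambda_{\max}>0$ such that $\sup_{x\in\mathbb{R}^n}\|\nabla^2h(x)\|_2\le\lambda_{\max}$. Let $\alpha\in(0,1)$. If there exists $c_J'\ge0$ such that $$h(A_k\hat x_k+B_ku_k)-c_J'\ \ge\ \alpha\,h(\hat x_k)\qquad\text{for all }\hat x_k\in\mathbb{R}^n,$$ then $$\mathbb{E}\big[h(\hat x_{k+1})\mid\hat x_k\big]\ \ge\ \alpha\,h(\hat x_k)+\delta',$$ where $$\delta'\le c_J'-\tfrac{\lambda_{\max}}{2}\mathrm{tr}\big(K_k\,\mathrm{cov}[v_k]\,K_k^\top\big)-\tfrac{\lambda_{\max}}{2}\mathrm{tr}\big(K_kC_kP_kC_k^\top K_k^\top\big).$$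
   Context: System: $x_k\in\mathbb{R}^n$ is the state, $u_k\in\mathbb{R}^m$ the input, $y_k\in\mathbb{R}^{n_y}$ the measurement, $w_k$ the disturbance and $v_k$ the measurement noise (of compatible dimensions); $A_k,B_k,C_k$ are matrices of compatible sizes. The disturbances $w_k$ and measurement noises $v_k$ are mutually independent zero-mean Gaussian white-noise processes with finite second moments. Kalman filter (one-step predictor): $\hat x_k=\mathbb{E}[x_k\mid y_0,\dots,y_{k-1}]$, with gain $K_k=A_kP_kC_k^\top(C_kP_kC_k^\top+R_k)^{-1}$ and prediction error covariance $P_k$ given by $P_{k+1}=A_kP_kA_k^\top+Q_k-A_kP_kC_k^\top(C_kP_kC_k^\top+R_k)^{-1}C_kP_kA_k^\top$, $P_0=\mathbb{E}[(x_0-\hat x_0)(x_0-\hat x_0)^\top]$, $Q_k=\mathbb{E}[w_kw_k^\top]$, $R_k=\mathbb{E}[v_kv_k^\top]$.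
   Formalization: The initial state x_0 is additionally assumed Gaussian (possibly degenerate) and independent of all w_k and v_k, without which the claim can fail; the input u_k is read as a measurable function of the estimate x̂_k. *)

theory Defs
  imports "HOL-Probability.Probability"
begin

definition gradient :: "(real ^ 'n \<Rightarrow> real) \<Rightarrow> real ^ 'n \<Rightarrow> real ^ 'n" where
  "gradient h x = (THE g. GDERIV h x :> g)"

definition hessian :: "(real ^ 'n \<Rightarrow> real) \<Rightarrow> real ^ 'n \<Rightarrow> real ^ 'n ^ 'n" where
  "hessian h x = jacobian (gradient h) (at x)"

definition twice_continuously_differentiable :: "(real ^ 'n \<Rightarrow> real) \<Rightarrow> bool" where
  "twice_continuously_differentiable h \<longleftrightarrow>
     h differentiable_on UNIV \<and> gradient h differentiable_on UNIV \<and>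
     continuous_on UNIV (hessian h)"

definition spectral_norm :: "real ^ 'n ^ 'm \<Rightarrow> real" where
  "spectral_norm A = onorm (\<lambda>x. A *v x)"

definition outer_product :: "real ^ 'n \<Rightarrow> real ^ 'm \<Rightarrow> real ^ 'm ^ 'n" where
  "outer_product a b = (\<chi> i j. a $ i * b $ j)"

definition covariance_matrix :: "'a measure \<Rightarrow> ('a \<Rightarrow> real ^ 'n) \<Rightarrow> real ^ 'n ^ 'n" where
  "covariance_matrix M X =
     (\<integral>\<omega>. outer_product (X \<omega> - (\<integral>\<omega>'. X \<omega>' \<partial>M)) (X \<omega> - (\<integral>\<omega>'. X \<omega>' \<partial>M)) \<partial>M)"

text \<open>Gaussian vectors may be degenerate: a linear functional that is almost surely constant
  counts as normal with variance zero. Singular covariance matrices are thus admitted.\<close>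

definition gaussian_vector :: "'a measure \<Rightarrow> ('a \<Rightarrow> real ^ 'n) \<Rightarrow> bool" where
  "gaussian_vector M X \<longleftrightarrow>
     X \<in> borel_measurable M \<and>
     (\<forall>a. \<exists>m. (AE \<omega> in M. a \<bullet> X \<omega> = m) \<or>
              (\<exists>s>0. distributed M lborel (\<lambda>\<omega>. a \<bullet> X \<omega>) (normal_density m s)))"

definition generated_by :: "'a measure \<Rightarrow> ('a \<Rightarrow> 'b::topological_space) \<Rightarrow> 'a measure" where
  "generated_by M X = vimage_algebra (space M) X borel"

text \<open>The \<open>\<sigma>\<close>-algebra of \<open>y 0, \<dots>, y (k - 1)\<close>; it is trivial for \<open>k = 0\<close>.\<close>

definition past_outputs :: "'a measure \<Rightarrow> (nat \<Rightarrow> 'a \<Rightarrow> real ^ 'p) \<Rightarrow> nat \<Rightarrow> 'a measure" where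
  "past_outputs M y k = sigma (space M) (\<Union>j<k. sets (generated_by M (y j)))"

text \<open>\<open>Y\<close> is a version of the conditional expectation of the random vector \<open>X\<close> given \<open>F\<close>.\<close>

definition is_vector_cond_exp ::
  "'a measure \<Rightarrow> 'a measure \<Rightarrow> ('a \<Rightarrow> real ^ 'n) \<Rightarrow> ('a \<Rightarrow> real ^ 'n) \<Rightarrow> bool" where
  "is_vector_cond_exp M F X Y \<longleftrightarrow>
     integrable M X \<and> Y \<in> borel_measurable F \<and>
     (\<forall>i. AE \<omega> in M. Y \<omega> $ i = real_cond_exp M F (\<lambda>\<omega>'. X \<omega>' $ i) \<omega>)"

text \<open>Mutual independence of the whole family consisting of the initial state, all
  disturbances and all measurement noises. It is expressed through generated
  \<open>\<sigma>\<close>-algebras because the vectors have different dimensions. In particular it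
  contains the whiteness of both noise processes.\<close>

datatype source = Initial | Disturbance nat | Noise nat

definition independent_sources ::
  "'a measure \<Rightarrow> ('a \<Rightarrow> real ^ 'n) \<Rightarrow> (nat \<Rightarrow> 'a \<Rightarrow> real ^ 'n) \<Rightarrow> (nat \<Rightarrow> 'a \<Rightarrow> real ^ 'p) \<Rightarrow> bool" where
  "independent_sources M x0 w v \<longleftrightarrow>
     prob_space.indep_sets M
       (\<lambda>s. case s of
              Initial \<Rightarrow> sets (generated_by M x0)
            | Disturbance j \<Rightarrow> sets (generated_by M (w j))
            | Noise j \<Rightarrow> sets (generated_by M (v j))) UNIV"

end

theory Submission
  imports Defs "HOL-Real_Asymp.Real_Asymp"
begin

text \<open>Write \<open>e k = x k - xhat k\<close> for the prediction error and \<open>z k = C k e k + v k\<close> for the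
  innovation, so that \<open>xhat (k + 1) = A k xhat k + B k u k + K k z k\<close>. Since the estimator recursion
  cancels the inputs, \<open>e k\<close> and \<open>z k\<close> are linear in the independent Gaussian sources even when the
  feedback is nonlinear. The predictor property makes \<open>z k\<close> uncorrelated with, hence independent of,
  the earlier innovations, and these generate every past output. So, conditionally on \<open>xhat k\<close>, the
  vector \<open>K k z k\<close> is centred with the constant second moment
  \<open>K k (C k P k C k\<^sup>T + R k) K k\<^sup>T\<close>. The second-order expansion of \<open>h\<close> at
  \<open>A k xhat k + B k u k\<close> with the Hessian bound then gives the estimate. As \<open>h (xhat (k + 1))\<close> need
  not be integrable, this is carried out on the \<open>xhat k\<close>-measurable sets where \<open>h\<close> and its gradient are
  bounded by \<open>N\<close> at that point.\<close>

section \<open>Second-order expansion\<close>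

text \<open>Uncorrelated innovations are independent only because they are jointly Gaussian, and
  their covariances may come from singular noise, so densities are no help. Laws are therefore
  handled through characteristic functions: for a linear functional of the sources the transform
  depends on the variance alone, so vanishing correlation makes transforms factor. Passing from
  factored transforms to independence of sigma-algebras is a uniqueness theorem for Fourier
  transforms, proved by Stone-Weierstrass approximation and a Dynkin-class argument. States and
  estimates need not be Gaussian when the feedback is nonlinear; only errors and innovations are.
  After time 0, \<open>P\<close> is given by the Riccati recursion and not as a covariance. That
  \<open>P k\<close> is the covariance of \<open>e k\<close> has to be proved; it rests on the gain
  equation K S = A P C^T, with S the innovation covariance. The two traces in the bound are the
  uncorrelated contributions of \<open>v k\<close> and \<open>C k e k\<close> to the innovation, and
  the factor 1/2 is that of the Taylor remainder. Independence from all past outputs passes to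
  \<open>xhat k\<close>, which is a function of them.\<close>

lemma gradient_GDERIV:
  assumes "h differentiable_on UNIV"
  shows "GDERIV h x :> gradient h x"
proof -
  obtain f where f: "(h has_derivative f) (at x)"
    using assms by (auto simp: differentiable_on_def differentiable_def)
  \<comment> \<open>\<open>gradient\<close> is a definite description, so existence and uniqueness
    are both due. The adjoint of the derivative, applied to 1, is its Riesz representative.\<close>
  define g where "g = adjoint f 1"
  have "f v = v \<bullet> g" for v
    using adjoint_works[OF has_derivative_linear[OF f], of v 1]
    by (simp add: g_def inner_real_def)
  then have "f = (\<lambda>v. v \<bullet> g)" by auto
  then have g: "GDERIV h x :> g"
    using f by (simp add: gderiv_def)
  have "\<exists>!g. GDERIV h x :> g"
  proof (rule ex1I[where a = g], rule g)
    fix g' assume "GDERIV h x :> g'"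
    then have "(\<lambda>v. v \<bullet> g') = (\<lambda>v. v \<bullet> g)"
      using g unfolding gderiv_def by (rule has_derivative_unique)
    then show "g' = g"
      by (metis inner_commute vector_eq_ldot)
  qed
  then show ?thesis
    unfolding gradient_def by (rule theI')
qed

lemma abs_quadratic_form_le_spectral_norm:
  fixes H :: "real ^ 'n ^ 'n"
  shows "\<bar>d \<bullet> (H *v d)\<bar> \<le> spectral_norm H * (norm d)\<^sup>2"
proof -
  have "norm (H *v d) \<le> spectral_norm H * norm d"
    unfolding spectral_norm_def by (intro onorm matrix_vector_mul_bounded_linear)
  then have "norm d * norm (H *v d) \<le> norm d * (spectral_norm H * norm d)"
    by (intro mult_left_mono) auto
  then show ?thesis
    using Cauchy_Schwarz_ineq2[of d "H *v d"] by (simp add: power2_eq_square mult_ac)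
qed

text \<open>Along the segment from \<open>a\<close> to \<open>a + d\<close> the Lagrange remainder
  is half the Hessian form at one intermediate point, hence \<open>L / 2\<close>. Both signs matter
  later: the lower side gives the estimate, the two-sided bound gives integrability after
  localisation.\<close>

lemma quadratic_taylor_bound:
  assumes C2: "twice_continuously_differentiable h"
    and bound: "\<And>\<xi>. spectral_norm (hessian h \<xi>) \<le> L"
  shows "\<bar>h (a + d) - h a - gradient h a \<bullet> d\<bar> \<le> L / 2 * (norm d)\<^sup>2"
proof -
  define diff where "diff = (\<lambda>(m::nat) (t::real). if m = 0 then h (a + t *\<^sub>R d)
      else if m = 1 then d \<bullet> gradient h (a + t *\<^sub>R d)
      else d \<bullet> (hessian h (a + t *\<^sub>R d) *v d))"
  have h: "(h has_derivative (\<lambda>v. v \<bullet> gradient h x)) (at x)" for x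
    using gradient_GDERIV C2 by (auto simp: twice_continuously_differentiable_def gderiv_def)
  have g: "(gradient h has_derivative (\<lambda>v. hessian h x *v v)) (at x)" for x
  proof -
    have "gradient h differentiable (at x)"
      using C2 by (auto simp: twice_continuously_differentiable_def differentiable_on_def)
    then show ?thesis
      using jacobian_works by (auto simp: hessian_def)
  qed
  have line: "((\<lambda>t. a + t *\<^sub>R d) has_derivative (\<lambda>s. s *\<^sub>R d)) (at t)" for t
    by (auto intro!: derivative_eq_intros)
  have D0: "DERIV (diff 0) t :> diff 1 t" for t
    using has_derivative_compose[OF line[of t] h]
    by (simp add: diff_def has_field_derivative_def mult_commute_abs)
  have D1: "DERIV (diff 1) t :> diff 2 t" for t
    using has_derivative_inner_right[OF has_derivative_compose[OF line[of t] g], of d]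
    by (simp add: diff_def has_field_derivative_def matrix_vector_mult_scaleR mult_commute_abs)
  have "\<forall>m t. m < 2 \<and> 0 \<le> t \<and> t \<le> 1 \<longrightarrow> DERIV (diff m) t :> diff (Suc m) t"
  proof (intro allI impI)
    fix m :: nat and t :: real assume "m < 2 \<and> 0 \<le> t \<and> t \<le> 1"
    then have "m = 0 \<or> m = 1" by auto
    then show "DERIV (diff m) t :> diff (Suc m) t"
      using D0[of t] D1[of t] by (auto simp: numeral_2_eq_2)
  qed
  from Maclaurin2[of 1 diff "diff 0" 2, OF _ refl this]
  obtain t where "diff 0 1 = (\<Sum>m<2. diff m 0 / fact m * 1 ^ m) + diff 2 t / fact 2 * 1 ^ 2"
    by auto
  then have eq: "h (a + d) - h a - gradient h a \<bullet> d = d \<bullet> (hessian h (a + t *\<^sub>R d) *v d) / 2"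
    by (simp add: diff_def numeral_2_eq_2 inner_commute)
  have "\<bar>d \<bullet> (hessian h (a + t *\<^sub>R d) *v d)\<bar> \<le> L * (norm d)\<^sup>2"
    by (rule order_trans[OF abs_quadratic_form_le_spectral_norm mult_right_mono[OF bound]]) simp
  then show ?thesis unfolding eq by simp
qed

section \<open>Uniqueness of Fourier transforms\<close>

text \<open>\<open>\<Phi>\<close> acts as the density of a complex measure whose image under
  \<open>Y\<close> has zero Fourier transform; the goal is that this image vanishes. Complex weights
  are allowed so that the class is stable under multiplication by characters of
  \<open>Y\<close>.\<close>

definition fourier_null :: "'a measure \<Rightarrow> ('a \<Rightarrow> 'b::euclidean_space) \<Rightarrow> ('a \<Rightarrow> complex) set" where
  "fourier_null M Y = {\<Phi>. integrable M \<Phi> \<and> (\<forall>t. (\<integral>\<omega>. \<Phi> \<omega> * iexp (t \<bullet> Y \<omega>) \<partial>M) = 0)}"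

lemma integrable_mult_bounded:
  fixes f g :: "'a \<Rightarrow> 'b::{real_normed_field, banach, second_countable_topology}"
  assumes "integrable M f" and [measurable]: "g \<in> borel_measurable M"
    and "\<And>\<omega>. norm (g \<omega>) \<le> B"
  shows "integrable M (\<lambda>\<omega>. f \<omega> * g \<omega>)"
proof (rule Bochner_Integration.integrable_bound)
  show "integrable M (\<lambda>\<omega>. B *\<^sub>R f \<omega>)" using assms by auto
  have [measurable]: "f \<in> borel_measurable M" using assms by auto
  show "(\<lambda>\<omega>. f \<omega> * g \<omega>) \<in> borel_measurable M" by measurable
  have "norm (f \<omega> * g \<omega>) \<le> norm (B *\<^sub>R f \<omega>)" for \<omega>
  proof -
    have "norm (f \<omega>) * norm (g \<omega>) \<le> norm (f \<omega>) * \<bar>B\<bar>"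
      using assms(3)[of \<omega>] by (intro mult_left_mono) auto
    then show ?thesis by (simp add: norm_mult mult.commute)
  qed
  then show "AE \<omega> in M. norm (f \<omega> * g \<omega>) \<le> norm (B *\<^sub>R f \<omega>)" by simp
qed

lemma integrable_mult_iexp:
  assumes "integrable M \<Phi>" and [measurable]: "f \<in> borel_measurable M"
  shows "integrable M (\<lambda>\<omega>. \<Phi> \<omega> * iexp (f \<omega>))"
  by (rule integrable_mult_bounded[where B = 1]) (use assms in auto)

lemma fourier_null_add:
  assumes [measurable]: "Y \<in> borel_measurable M"
    and "\<Phi> \<in> fourier_null M Y" "\<Psi> \<in> fourier_null M Y"
  shows "(\<lambda>\<omega>. \<Phi> \<omega> + \<Psi> \<omega>) \<in> fourier_null M Y"
  using assms by (simp add: fourier_null_def distrib_right integrable_mult_iexp)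

lemma fourier_null_cmult:
  assumes "\<Phi> \<in> fourier_null M Y"
  shows "(\<lambda>\<omega>. \<Phi> \<omega> * c) \<in> fourier_null M Y"
proof -
  have "(\<integral>\<omega>. \<Phi> \<omega> * c * iexp (t \<bullet> Y \<omega>) \<partial>M) = (\<integral>\<omega>. c * (\<Phi> \<omega> * iexp (t \<bullet> Y \<omega>)) \<partial>M)" for t
    by (simp add: mult_ac)
  then show ?thesis
    using assms by (auto simp: fourier_null_def)
qed

lemma fourier_null_sum:
  assumes Y: "Y \<in> borel_measurable M" and "\<And>i. i \<in> I \<Longrightarrow> \<Phi> i \<in> fourier_null M Y"
  shows "(\<lambda>\<omega>. \<Sum>i\<in>I. \<Phi> i \<omega>) \<in> fourier_null M Y"
  using assms(2)
proof (induction I rule: infinite_finite_induct)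
  case (insert i I)
  then show ?case by (auto intro!: fourier_null_add[OF Y])
qed (auto simp: fourier_null_def)

text \<open>Multiplying by a character of \<open>Y\<close> merely shifts the frequency. With
  linearity, trigonometric polynomials in \<open>Y\<close> can thus be absorbed into the
  weight.\<close>

lemma fourier_null_iexp:
  assumes [measurable]: "Y \<in> borel_measurable M" and \<Phi>: "\<Phi> \<in> fourier_null M Y"
  shows "(\<lambda>\<omega>. \<Phi> \<omega> * iexp (s \<bullet> Y \<omega>)) \<in> fourier_null M Y"
proof -
  have "(\<integral>\<omega>. \<Phi> \<omega> * iexp (s \<bullet> Y \<omega>) * iexp (t \<bullet> Y \<omega>) \<partial>M)
      = (\<integral>\<omega>. \<Phi> \<omega> * iexp ((s + t) \<bullet> Y \<omega>) \<partial>M)" for t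
    by (simp add: inner_add_left ring_distribs exp_add mult.assoc)
  then show ?thesis
    using \<Phi> by (auto simp: fourier_null_def integrable_mult_iexp)
qed

lemma fourier_null_sin:
  assumes Y: "Y \<in> borel_measurable M" and \<Phi>: "\<Phi> \<in> fourier_null M Y"
  shows "(\<lambda>\<omega>. \<Phi> \<omega> * of_real (sin (s \<bullet> Y \<omega>))) \<in> fourier_null M Y"
proof -
  have "complex_of_real (sin r) = iexp r * (1 / (2 * \<i>)) + iexp (- r) * (- 1 / (2 * \<i>))" for r
    by (simp add: sin_of_real[symmetric] sin_exp_eq field_simps)
  then have "(\<lambda>\<omega>. \<Phi> \<omega> * of_real (sin (s \<bullet> Y \<omega>)))
      = (\<lambda>\<omega>. \<Phi> \<omega> * iexp (s \<bullet> Y \<omega>) * (1 / (2 * \<i>))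
            + \<Phi> \<omega> * iexp ((- s) \<bullet> Y \<omega>) * (- 1 / (2 * \<i>)))"
    by (simp only: distrib_left mult.assoc inner_minus_left)
  also have "\<dots> \<in> fourier_null M Y"
    by (intro fourier_null_add fourier_null_cmult fourier_null_iexp Y \<Phi>)
  finally show ?thesis .
qed

text \<open>A bounded surrogate of the identity whose coordinates are trigonometric; it converges to
  the identity as \<open>L\<close> grows. Composing with polynomials thus stays in the span of the
  characters.\<close>

definition sine_box :: "real \<Rightarrow> 'b::euclidean_space \<Rightarrow> 'b" where
  "sine_box L y = (\<Sum>b\<in>Basis. (L * sin ((y \<bullet> b) / L)) *\<^sub>R b)"

lemma sine_box_inner: "b \<in> Basis \<Longrightarrow> sine_box L y \<bullet> b = L * sin ((y \<bullet> b) / L)"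
  by (simp add: sine_box_def)

lemma sine_box_measurable [measurable]: "sine_box L \<in> borel_measurable borel"
  unfolding sine_box_def[abs_def] by measurable

lemma sine_box_tendsto: "(\<lambda>n. sine_box (real (Suc n)) y) \<longlonglongrightarrow> y"
proof -
  have "(\<lambda>n. real (Suc n) * sin (r / real (Suc n))) \<longlonglongrightarrow> r" for r
    by real_asymp
  then have "(\<lambda>n. sine_box (real (Suc n)) y) \<longlonglongrightarrow> (\<Sum>b\<in>Basis. (y \<bullet> b) *\<^sub>R b)"
    unfolding sine_box_def by (intro tendsto_intros)
  then show ?thesis by (simp add: euclidean_representation)
qed

text \<open>The weight stays arbitrary in the induction: for a product, one factor is absorbed into
  the weight and the hypothesis for the other factor is applied to the result.\<close>

lemma fourier_null_polynomial_sine_box: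
  assumes Y: "Y \<in> borel_measurable M" and "real_polynomial_function p"
    and "\<Phi> \<in> fourier_null M Y"
  shows "(\<lambda>\<omega>. \<Phi> \<omega> * of_real (p (sine_box L (Y \<omega>)))) \<in> fourier_null M Y"
  using assms(2,3)
proof (induction p arbitrary: \<Phi>)
  case (linear f)
  interpret bounded_linear f by fact
  have "complex_of_real (f (sine_box L y))
      = (\<Sum>b\<in>Basis. of_real (sin ((b /\<^sub>R L) \<bullet> y)) * of_real (L * f b))" for y
    by (simp add: sine_box_def sum scaleR mult_ac inner_commute divide_inverse)
  then have eq: "(\<lambda>\<omega>. \<Phi> \<omega> * of_real (f (sine_box L (Y \<omega>))))
      = (\<lambda>\<omega>. \<Sum>b\<in>Basis. \<Phi> \<omega> * of_real (sin ((b /\<^sub>R L) \<bullet> Y \<omega>)) * of_real (L * f b))"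
    by (simp only: sum_distrib_left mult.assoc)
  show ?case
    unfolding eq by (intro fourier_null_sum fourier_null_cmult fourier_null_sin Y linear.prems)
next
  case (const c)
  then show ?case by (rule fourier_null_cmult)
next
  case (add f g)
  then show ?case
    using fourier_null_add[OF Y add.IH(1) add.IH(2)] by (simp add: distrib_left)
next
  case (mult f g)
  then show ?case
    using mult.IH(2)[OF mult.IH(1)] by (simp add: mult.assoc)
qed

text \<open>Stone-Weierstrass needs a compact domain, while \<open>Y\<close> is unbounded. Composing
  with \<open>sine_box L\<close> confines the argument to a cube without leaving the trigonometric
  functions of \<open>Y\<close>; dominated convergence then removes the confinement.\<close>

lemma fourier_null_integral_continuous:
  fixes f :: "'b::euclidean_space \<Rightarrow> real"
  assumes Y[measurable]: "Y \<in> borel_measurable M" and \<Phi>: "\<Phi> \<in> fourier_null M Y"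
    and f: "continuous_on UNIV f" and bound: "\<And>y. \<bar>f y\<bar> \<le> K"
  shows "(\<integral>\<omega>. \<Phi> \<omega> * of_real (f (Y \<omega>)) \<partial>M) = 0"
proof -
  have int: "integrable M \<Phi>" using \<Phi> by (simp add: fourier_null_def)
  then have [measurable]: "\<Phi> \<in> borel_measurable M" by auto
  have [measurable]: "f \<in> borel_measurable borel"
    using f by (rule borel_measurable_continuous_onI)
  have zero: "(\<integral>\<omega>. \<Phi> \<omega> * of_real (f (sine_box L (Y \<omega>))) \<partial>M) = 0" if "L > 0" for L
  proof -
    define I where "I = (\<integral>\<omega>. \<Phi> \<omega> * of_real (f (sine_box L (Y \<omega>))) \<partial>M)"
    \<comment> \<open>This cube contains the whole range of \<open>sine_box L\<close>, so
      approximation on \<open>S\<close> is uniform in \<open>\<omega>\<close>.\<close>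
    define S :: "'b set" where "S = cbox (- L *\<^sub>R One) (L *\<^sub>R One)"
    have S: "sine_box L y \<in> S" for y
    proof -
      have "L * - 1 \<le> L * sin r \<and> L * sin r \<le> L * 1" for r
        using \<open>L > 0\<close> by (intro conjI mult_left_mono) auto
      then show ?thesis by (auto simp: S_def mem_box sine_box_inner)
    qed
    have le: "norm I \<le> e * (\<integral>\<omega>. norm (\<Phi> \<omega>) \<partial>M)" if "e > 0" for e
    proof -
      obtain p where p: "real_polynomial_function p" "\<And>y. y \<in> S \<Longrightarrow> \<bar>f y - p y\<bar> < e"
        using Stone_Weierstrass_real_polynomial_function[of S f e] \<open>e > 0\<close>
          continuous_on_subset[OF f, of S] by (auto simp: S_def)
      have [measurable]: "p \<in> borel_measurable borel"
        using continuous_on_polymonial_function p(1) real_polynomial_function_eq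
        by (metis borel_measurable_continuous_onI)
      have "(\<lambda>\<omega>. \<Phi> \<omega> * of_real (p (sine_box L (Y \<omega>)))) \<in> fourier_null M Y"
        by (rule fourier_null_polynomial_sine_box[OF Y p(1) \<Phi>])
      then have P: "(\<integral>\<omega>. \<Phi> \<omega> * of_real (p (sine_box L (Y \<omega>))) \<partial>M) = 0"
        "integrable M (\<lambda>\<omega>. \<Phi> \<omega> * of_real (p (sine_box L (Y \<omega>))))"
        by (auto simp: fourier_null_def dest: spec[of _ 0])
      have F: "integrable M (\<lambda>\<omega>. \<Phi> \<omega> * of_real (f (sine_box L (Y \<omega>))))"
        by (rule integrable_mult_bounded[OF int, where B = K]) (auto simp: bound)
      have "I = (\<integral>\<omega>. \<Phi> \<omega> * of_real (f (sine_box L (Y \<omega>)))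
                    - \<Phi> \<omega> * of_real (p (sine_box L (Y \<omega>))) \<partial>M)"
        using P F by (simp add: I_def)
      also have "norm \<dots> \<le> (\<integral>\<omega>. norm (\<Phi> \<omega>) * e \<partial>M)"
      proof (rule order_trans[OF integral_norm_bound integral_mono])
        show "integrable M (\<lambda>\<omega>. norm (\<Phi> \<omega>) * e)" using int by auto
        fix \<omega>
        have "norm (of_real (f (sine_box L (Y \<omega>))) - of_real (p (sine_box L (Y \<omega>))) :: complex) \<le> e"
          unfolding of_real_diff[symmetric] norm_of_real
          using p(2)[OF S, of "Y \<omega>"] by simp
        then show "norm (\<Phi> \<omega> * of_real (f (sine_box L (Y \<omega>)))
            - \<Phi> \<omega> * of_real (p (sine_box L (Y \<omega>)))) \<le> norm (\<Phi> \<omega>) * e"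
          unfolding right_diff_distrib[symmetric] norm_mult by (rule mult_left_mono) simp
      qed (use P F in auto)
      finally show ?thesis by (simp add: mult.commute)
    qed
    have "((\<lambda>e. e * (\<integral>\<omega>. norm (\<Phi> \<omega>) \<partial>M)) \<longlongrightarrow> 0 * (\<integral>\<omega>. norm (\<Phi> \<omega>) \<partial>M)) (at_right 0)"
      by (intro tendsto_intros)
    moreover have "eventually (\<lambda>e. norm I \<le> e * (\<integral>\<omega>. norm (\<Phi> \<omega>) \<partial>M)) (at_right 0)"
      using eventually_at_right_less by (rule eventually_mono) (rule le)
    ultimately have "norm I \<le> 0 * (\<integral>\<omega>. norm (\<Phi> \<omega>) \<partial>M)"
      by (rule tendsto_lowerbound) simp
    then show ?thesis by (simp add: I_def)
  qed
  have "(\<lambda>n. \<integral>\<omega>. \<Phi> \<omega> * of_real (f (sine_box (real (Suc n)) (Y \<omega>))) \<partial>M)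
      \<longlonglongrightarrow> (\<integral>\<omega>. \<Phi> \<omega> * of_real (f (Y \<omega>)) \<partial>M)"
  proof (rule integral_dominated_convergence[where w = "\<lambda>\<omega>. norm (\<Phi> \<omega>) * K"])
    show "integrable M (\<lambda>\<omega>. norm (\<Phi> \<omega>) * K)" using int by auto
    have "(\<lambda>n. f (sine_box (real (Suc n)) y)) \<longlonglongrightarrow> f y" for y
      by (rule continuous_on_tendsto_compose[OF f sine_box_tendsto]) auto
    then show "AE \<omega> in M. (\<lambda>n. \<Phi> \<omega> * of_real (f (sine_box (real (Suc n)) (Y \<omega>))))
        \<longlonglongrightarrow> \<Phi> \<omega> * of_real (f (Y \<omega>))"
      by (intro AE_I2 tendsto_intros)
    show "AE \<omega> in M. norm (\<Phi> \<omega> * of_real (f (sine_box (real (Suc n)) (Y \<omega>)))) \<le> norm (\<Phi> \<omega>) * K" for n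
      by (auto simp: norm_mult intro!: mult_left_mono bound)
  qed measurable
  then have "(\<lambda>n::nat. 0) \<longlonglongrightarrow> (\<integral>\<omega>. \<Phi> \<omega> * of_real (f (Y \<omega>)) \<partial>M)"
    by (subst (asm) zero) auto
  then show ?thesis by (simp add: LIMSEQ_const_iff)
qed

text \<open>The indicator of a closed set is a pointwise limit of continuous cutoffs in [0, 1] that
  fall off linearly with the distance to the set.\<close>

lemma fourier_null_integral_closed:
  fixes Y :: "'a \<Rightarrow> 'b::euclidean_space"
  assumes Y[measurable]: "Y \<in> borel_measurable M" and \<Phi>: "\<Phi> \<in> fourier_null M Y"
    and C: "closed C"
  shows "(\<integral>\<omega>. \<Phi> \<omega> * of_real (indicator C (Y \<omega>)) \<partial>M) = 0"
\<comment> \<open>The empty set is treated apart because \<open>infdist\<close> to it is 0 by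
  default, so the cutoffs would be constantly 1.\<close>
proof (cases "C = {}")
  case False
  define f where "f n y = max 0 (1 - real n * infdist y C)" for n y
  have int: "integrable M \<Phi>" using \<Phi> by (simp add: fourier_null_def)
  then have [measurable]: "\<Phi> \<in> borel_measurable M" by auto
  have [measurable]: "C \<in> sets borel" using C by auto
  have f: "continuous_on UNIV (f n)" for n
    unfolding f_def by (intro continuous_intros)
  have bound: "\<bar>f n y\<bar> \<le> 1" for n y
    by (auto simp: f_def infdist_nonneg)
  have [measurable]: "f n \<in> borel_measurable borel" for n
    using f by (rule borel_measurable_continuous_onI)
  have lim: "(\<lambda>n. f n y) \<longlonglongrightarrow> indicator C y" for y
  proof (cases "y \<in> C")
    case True
    then show ?thesis by (simp add: f_def)
  next
    case notin: False
    define r where "r = infdist y C"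
    have "r > 0" unfolding r_def by (rule infdist_pos_not_in_closed[OF C False notin])
    then have "eventually (\<lambda>n. 1 / r \<le> real n) sequentially"
      by real_asymp
    then have "eventually (\<lambda>n. f n y = 0) sequentially"
      by eventually_elim (use \<open>r > 0\<close> in \<open>auto simp: f_def r_def[symmetric] field_simps\<close>)
    then show ?thesis using notin by (simp add: tendsto_eventually)
  qed
  have "(\<lambda>n. \<integral>\<omega>. \<Phi> \<omega> * of_real (f n (Y \<omega>)) \<partial>M)
      \<longlonglongrightarrow> (\<integral>\<omega>. \<Phi> \<omega> * of_real (indicator C (Y \<omega>)) \<partial>M)"
  proof (rule integral_dominated_convergence[where w = "\<lambda>\<omega>. norm (\<Phi> \<omega>)"])
        show "AE \<omega> in M. (\<lambda>n. \<Phi> \<omega> * of_real (f n (Y \<omega>))) \<longlonglongrightarrow> \<Phi> \<omega> * of_real (indicator C (Y \<omega>))"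
      by (intro AE_I2 tendsto_intros lim)
    show "AE \<omega> in M. norm (\<Phi> \<omega> * of_real (f n (Y \<omega>))) \<le> norm (\<Phi> \<omega>)" for n
      by (auto simp: norm_mult intro!: mult_right_le_one_le bound)
    show "integrable M (\<lambda>\<omega>. norm (\<Phi> \<omega>))" using int by auto
  qed measurable
  then have "(\<lambda>n::nat. 0) \<longlonglongrightarrow> (\<integral>\<omega>. \<Phi> \<omega> * of_real (indicator C (Y \<omega>)) \<partial>M)"
    by (subst (asm) fourier_null_integral_continuous[OF Y \<Phi> f bound])
  then show ?thesis by (simp add: LIMSEQ_const_iff)
qed simp

text \<open>Dynkin's argument: the sets over which the integral vanishes are closed under
  complements and countable disjoint unions. The integral over the whole space is a separate premise
  since \<open>G\<close> need not contain \<open>space M\<close>.\<close>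

lemma set_integral_zero_sigma_sets:
  fixes \<Phi> :: "'a \<Rightarrow> 'c::{banach, second_countable_topology}"
  assumes int: "integrable M \<Phi>" and G: "Int_stable G" "G \<subseteq> sets M"
    and zero: "\<And>D. D \<in> G \<Longrightarrow> (LINT \<omega>:D|M. \<Phi> \<omega>) = 0" "(\<integral>\<omega>. \<Phi> \<omega> \<partial>M) = 0"
    and D: "D \<in> sigma_sets (space M) G"
  shows "(LINT \<omega>:D|M. \<Phi> \<omega>) = 0"
proof -
  have sub: "G \<subseteq> Pow (space M)" using G(2) sets.sets_into_space by blast
  have meas: "X \<in> sets M" if "X \<in> sigma_sets (space M) G" for X
    using that G(2) sets.sigma_sets_subset by blast
  have si: "set_integrable M X \<Phi>" if "X \<in> sets M" for X
    unfolding set_integrable_def using integrable_mult_indicator[OF that int] .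
  show ?thesis using G(1) sub D
  proof (induction rule: sigma_sets_induct_disjoint)
    case (basic X)
    then show ?case by (rule zero(1))
  next
    case empty
    then show ?case by (simp add: set_lebesgue_integral_def)
  next
    case (compl X)
    have X: "X \<in> sets M" using compl meas by blast
    have "(LINT \<omega>:space M|M. \<Phi> \<omega>) = (LINT \<omega>:X|M. \<Phi> \<omega>) + (LINT \<omega>:(space M - X)|M. \<Phi> \<omega>)"
      using set_integral_Un[of X "space M - X" M \<Phi>] X si sets.sets_into_space[OF X]
      by (simp add: Un_absorb1 sets.compl_sets)
    then show ?case
      using compl zero(2) by (simp add: set_integral_space int)
  next
    case (union X)
    have X: "X i \<in> sets M" for i using union meas by blast
    have "(LINT \<omega>:(\<Union>i. X i)|M. \<Phi> \<omega>) = (\<Sum>i. LINT \<omega>:X i|M. \<Phi> \<omega>)"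
      using union X si by (intro lebesgue_integral_countable_add) (auto simp: disjoint_family_on_def)
    then show ?case using union by simp
  qed
qed

text \<open>The uniqueness theorem in the form used below: a zero transform forces a zero integral
  over every event of \<open>Y\<close>. Preimages of closed sets are an intersection-stable
  generator of these events.\<close>

lemma set_integral_zero_fourier:
  assumes Y[measurable]: "Y \<in> borel_measurable M" and \<Phi>: "\<Phi> \<in> fourier_null M Y"
    and B: "B \<in> sets borel"
  shows "(LINT \<omega>:(Y -` B \<inter> space M)|M. \<Phi> \<omega>) = 0"
proof -
  define G where "G = {Y -` C \<inter> space M | C. closed C}"
  have int: "integrable M \<Phi>" using \<Phi> by (simp add: fourier_null_def)
  have "sigma_sets (space M) G = {Y -` C \<inter> space M | C. C \<in> sigma_sets UNIV (Collect closed)}"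
    unfolding G_def using sigma_sets_vimage_commute[of Y "space M" UNIV "Collect closed"] by auto
  then have "Y -` B \<inter> space M \<in> sigma_sets (space M) G"
    using B by (auto simp: borel_eq_closed)
  moreover have "Int_stable G"
    unfolding Int_stable_def G_def
  proof safe
    fix C C' :: "'b set" assume "closed C" "closed C'"
    then show "\<exists>Ca. Y -` C \<inter> space M \<inter> (Y -` C' \<inter> space M) = Y -` Ca \<inter> space M \<and> closed Ca"
      by (intro exI[of _ "C \<inter> C'"]) auto
  qed
  moreover have "G \<subseteq> sets M" by (auto simp: G_def)
  moreover have "(LINT \<omega>:D|M. \<Phi> \<omega>) = 0" if "D \<in> G" for D
  proof -
    have "\<exists>C. D = Y -` C \<inter> space M \<and> closed C" using that by (simp add: G_def)
    then obtain C where C: "closed C" "D = Y -` C \<inter> space M" by (elim exE conjE)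
    have "(LINT \<omega>:D|M. \<Phi> \<omega>) = (\<integral>\<omega>. \<Phi> \<omega> * of_real (indicator C (Y \<omega>)) \<partial>M)"
      unfolding set_lebesgue_integral_def C(2)
      by (intro Bochner_Integration.integral_cong) (auto simp: indicator_def)
    then show ?thesis using fourier_null_integral_closed[OF Y \<Phi> C(1)] by simp
  qed
  moreover have "(\<integral>\<omega>. \<Phi> \<omega> \<partial>M) = 0"
    using \<Phi> by (auto simp: fourier_null_def dest: spec[of _ 0])
  ultimately show ?thesis
    using set_integral_zero_sigma_sets[OF int] by blast
qed

section \<open>Linear spans of independent Gaussian vectors\<close>

lemma integrable_mult_square_integrable:
  fixes f g :: "'a \<Rightarrow> real"
  assumes [measurable]: "f \<in> borel_measurable M" "g \<in> borel_measurable M"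
    and "integrable M (\<lambda>\<omega>. (f \<omega>)\<^sup>2)" "integrable M (\<lambda>\<omega>. (g \<omega>)\<^sup>2)"
  shows "integrable M (\<lambda>\<omega>. f \<omega> * g \<omega>)"
proof (rule Bochner_Integration.integrable_bound)
  show "integrable M (\<lambda>\<omega>. (f \<omega>)\<^sup>2 + (g \<omega>)\<^sup>2)" using assms by auto
  have "\<bar>r * s\<bar> \<le> r\<^sup>2 + s\<^sup>2" for r s :: real
  proof -
    have "2 * (\<bar>r\<bar> * \<bar>s\<bar>) \<le> r\<^sup>2 + s\<^sup>2"
      using sum_squares_bound[of "\<bar>r\<bar>" "\<bar>s\<bar>"] by simp
    moreover have "0 \<le> \<bar>r\<bar> * \<bar>s\<bar>" by simp
    ultimately show ?thesis unfolding abs_mult by linarith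
  qed
  then show "AE \<omega> in M. norm (f \<omega> * g \<omega>) \<le> norm ((f \<omega>)\<^sup>2 + (g \<omega>)\<^sup>2)"
    by (intro AE_I2) (simp add: abs_of_nonneg)
qed measurable

text \<open>A normal law of mean zero, possibly degenerate, recorded only by its transform at
  frequency 1. The functionals to which it is applied form linear spaces, so scaling recovers all
  other frequencies.\<close>

definition centered_normal :: "'a measure \<Rightarrow> ('a \<Rightarrow> real) \<Rightarrow> bool" where
  "centered_normal M T \<longleftrightarrow>
     T \<in> borel_measurable M \<and> integrable M (\<lambda>\<omega>. (T \<omega>)\<^sup>2) \<and> (\<integral>\<omega>. T \<omega> \<partial>M) = 0 \<and>
     (\<integral>\<omega>. iexp (T \<omega>) \<partial>M) = of_real (exp (- (\<integral>\<omega>. (T \<omega>)\<^sup>2 \<partial>M) / 2))"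

section \<open>Gaussian vectors seen through their real functionals\<close>

context prob_space
begin

lemma normal_centered_normal:
  assumes \<sigma>: "\<sigma> > 0" and D: "distributed M lborel T (normal_density m \<sigma>)"
  shows "integrable M T" "centered_normal M (\<lambda>\<omega>. T \<omega> - expectation T)"
proof -
  have [measurable]: "T \<in> borel_measurable M" using D by (simp add: distributed_def)
  have m: "expectation T = m" using normal_distributed_expectation[OF \<sigma> D] .
  define Z where "Z \<omega> = (T \<omega> - m) / \<sigma>" for \<omega>
  have Z: "distributed M lborel Z std_normal_density"
    using D normal_standard_normal_convert[OF \<sigma>] by (simp add: Z_def[abs_def])
  have [measurable]: "Z \<in> borel_measurable M" unfolding Z_def by measurable
  have T: "T = (\<lambda>\<omega>. m + \<sigma> * Z \<omega>)" using \<sigma> by (auto simp: Z_def)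
  have "integrable M (\<lambda>\<omega>. Z \<omega> ^ k)" for k
    using distributed_integrable[OF Z, of "\<lambda>x. x ^ k"] integrable_std_normal_moment[of k] by simp
  note intZ = this[of 1] this[of 2]
  then show "integrable M T" unfolding T by simp
  have "(\<integral>\<omega>. iexp (\<sigma> * Z \<omega>) \<partial>M) = char (distr M lborel Z) \<sigma>"
    by (simp add: char_def integral_distr)
  also have "\<dots> = char std_normal_distribution \<sigma>"
    using distributed_distr_eq_density[OF Z] by simp
  also have "\<dots> = of_real (exp (- \<sigma>\<^sup>2 / 2))"
    by (simp add: char_std_normal_distribution)
  finally have ch: "(\<integral>\<omega>. iexp (T \<omega> - m) \<partial>M) = of_real (exp (- \<sigma>\<^sup>2 / 2))"
    by (simp add: T)
  show "centered_normal M (\<lambda>\<omega>. T \<omega> - expectation T)"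
    unfolding centered_normal_def
  proof (intro conjI)
    show "integrable M (\<lambda>\<omega>. (T \<omega> - expectation T)\<^sup>2)"
      unfolding m using intZ by (simp add: T power_mult_distrib)
    show "(\<integral>\<omega>. T \<omega> - expectation T \<partial>M) = 0"
      using \<open>integrable M T\<close> by (simp add: prob_space)
    show "(\<integral>\<omega>. iexp (T \<omega> - expectation T) \<partial>M)
        = of_real (exp (- (\<integral>\<omega>. (T \<omega> - expectation T)\<^sup>2 \<partial>M) / 2))"
      using ch normal_distributed_variance[OF \<sigma> D] by (simp add: m)
  qed measurable
qed

lemma gaussian_vector_functional:
  assumes "gaussian_vector M X"
  shows "integrable M (\<lambda>\<omega>. a \<bullet> X \<omega>)"
    "centered_normal M (\<lambda>\<omega>. a \<bullet> X \<omega> - (\<integral>\<omega>. a \<bullet> X \<omega> \<partial>M))"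
proof -
  have [measurable]: "X \<in> borel_measurable M" using assms by (simp add: gaussian_vector_def)
  obtain m where "(AE \<omega> in M. a \<bullet> X \<omega> = m) \<or>
      (\<exists>s>0. distributed M lborel (\<lambda>\<omega>. a \<bullet> X \<omega>) (normal_density m s))"
    using assms unfolding gaussian_vector_def by blast
  then have "integrable M (\<lambda>\<omega>. a \<bullet> X \<omega>) \<and>
      centered_normal M (\<lambda>\<omega>. a \<bullet> X \<omega> - (\<integral>\<omega>. a \<bullet> X \<omega> \<partial>M))"
  proof
    \<comment> \<open>Degenerate case: variance zero, and the transform is exp 0 = 1.\<close>
    assume m: "AE \<omega> in M. a \<bullet> X \<omega> = m"
    have "(\<integral>\<omega>. a \<bullet> X \<omega> \<partial>M) = (\<integral>\<omega>. m \<partial>M)"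
      by (rule integral_cong_AE) (use m in auto)
    then have E: "(\<integral>\<omega>. a \<bullet> X \<omega> \<partial>M) = m" by (simp add: prob_space)
    have int: "integrable M (\<lambda>\<omega>. a \<bullet> X \<omega>)"
      by (subst integrable_cong_AE[where g = "\<lambda>_. m"]) (use m in auto)
    have sq: "AE \<omega> in M. (a \<bullet> X \<omega> - m)\<^sup>2 = 0" and ex: "AE \<omega> in M. iexp (a \<bullet> X \<omega> - m) = 1"
      using m by (auto elim!: eventually_mono)
    have "integrable M (\<lambda>\<omega>. (a \<bullet> X \<omega> - m)\<^sup>2)"
      by (subst integrable_cong_AE[where g = "\<lambda>_. 0"]) (use sq in auto)
    moreover have "(\<integral>\<omega>. (a \<bullet> X \<omega> - m)\<^sup>2 \<partial>M) = (\<integral>\<omega>. 0 \<partial>M)"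
      by (rule integral_cong_AE) (use sq in auto)
    moreover have "(\<integral>\<omega>. iexp (a \<bullet> X \<omega> - m) \<partial>M) = (\<integral>\<omega>. 1 \<partial>M)"
      by (rule integral_cong_AE) (use ex in auto)
    ultimately show ?thesis
      using int by (simp add: centered_normal_def E prob_space del: of_real_diff)
  next
    assume "\<exists>s>0. distributed M lborel (\<lambda>\<omega>. a \<bullet> X \<omega>) (normal_density m s)"
    then show ?thesis using normal_centered_normal by blast
  qed
  then show "integrable M (\<lambda>\<omega>. a \<bullet> X \<omega>)"
    "centered_normal M (\<lambda>\<omega>. a \<bullet> X \<omega> - (\<integral>\<omega>. a \<bullet> X \<omega> \<partial>M))" by auto
qed

lemma gaussian_vector_integrable:
  assumes "gaussian_vector M X"
  shows "integrable M X"
proof -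
  have "integrable M (\<lambda>\<omega>. \<Sum>b\<in>Basis. (b \<bullet> X \<omega>) *\<^sub>R b)"
    by (intro Bochner_Integration.integrable_sum integrable_scaleR_left
        gaussian_vector_functional(1)[OF assms])
  then show ?thesis by (simp add: euclidean_representation inner_commute[of _ "X _"])
qed

lemma gaussian_vector_centered_normal:
  assumes "gaussian_vector M X"
  shows "centered_normal M (\<lambda>\<omega>. a \<bullet> (X \<omega> - expectation X))"
  using gaussian_vector_functional(2)[OF assms, of a] gaussian_vector_integrable[OF assms]
  by (simp add: inner_diff_right)

end

text \<open>Sources have different dimensions, so each one is represented by a sigma-algebra
  \<open>F s\<close> and by the space \<open>V s\<close> of its centred real functionals; one index
  type then covers them all.\<close>

locale gaussian_sources = prob_space M for M :: "'a measure" +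
  fixes F :: "'i \<Rightarrow> 'a measure" and V :: "'i \<Rightarrow> ('a \<Rightarrow> real) set"
  assumes indep: "indep_sets (\<lambda>s. sets (F s)) UNIV"
    and space_F: "space (F s) = space M"
    and V_measurable: "T \<in> V s \<Longrightarrow> T \<in> borel_measurable (F s)"
    and V_zero: "(\<lambda>_. 0) \<in> V s"
    and V_add: "T \<in> V s \<Longrightarrow> U \<in> V s \<Longrightarrow> (\<lambda>\<omega>. T \<omega> + U \<omega>) \<in> V s"
    and V_scale: "T \<in> V s \<Longrightarrow> (\<lambda>\<omega>. r * T \<omega>) \<in> V s"
    and V_normal: "T \<in> V s \<Longrightarrow> centered_normal M T"
begin

text \<open>One functional per source suffices, because each \<open>V s\<close> is already closed
  under addition. Equality is asked only on \<open>space M\<close>, where the system equations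
  hold.\<close>

definition lin :: "'i set \<Rightarrow> ('a \<Rightarrow> real) set" where
  "lin S = {T. \<exists>f. (\<forall>s\<in>S. f s \<in> V s) \<and> (\<forall>\<omega>\<in>space M. T \<omega> = (\<Sum>s\<in>S. f s \<omega>))}"

lemma linE:
  assumes "T \<in> lin S"
  obtains f where "\<And>s. s \<in> S \<Longrightarrow> f s \<in> V s" "\<And>\<omega>. \<omega> \<in> space M \<Longrightarrow> T \<omega> = (\<Sum>s\<in>S. f s \<omega>)"
  using assms by (auto simp: lin_def)

lemma linI:
  assumes "\<And>s. s \<in> S \<Longrightarrow> f s \<in> V s" "\<And>\<omega>. \<omega> \<in> space M \<Longrightarrow> T \<omega> = (\<Sum>s\<in>S. f s \<omega>)"
  shows "T \<in> lin S"
  using assms by (auto simp: lin_def)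

lemma lin_cong:
  assumes "T \<in> lin S" "\<And>\<omega>. \<omega> \<in> space M \<Longrightarrow> U \<omega> = T \<omega>"
  shows "U \<in> lin S"
  using assms by (auto simp: lin_def)

lemma lin_zero: "(\<lambda>_. 0) \<in> lin S"
  by (rule linI[of S "\<lambda>_ _. 0"]) (auto intro: V_zero)

lemma lin_add:
  assumes "T \<in> lin S" "U \<in> lin S"
  shows "(\<lambda>\<omega>. T \<omega> + U \<omega>) \<in> lin S"
proof -
  obtain f where f: "\<And>s. s \<in> S \<Longrightarrow> f s \<in> V s" "\<And>\<omega>. \<omega> \<in> space M \<Longrightarrow> T \<omega> = (\<Sum>s\<in>S. f s \<omega>)"
    using linE[OF assms(1)] by blast
  obtain g where g: "\<And>s. s \<in> S \<Longrightarrow> g s \<in> V s" "\<And>\<omega>. \<omega> \<in> space M \<Longrightarrow> U \<omega> = (\<Sum>s\<in>S. g s \<omega>)"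
    using linE[OF assms(2)] by blast
  show ?thesis
    by (rule linI[of S "\<lambda>s \<omega>. f s \<omega> + g s \<omega>"]) (auto simp: f g V_add sum.distrib)
qed

lemma lin_scale:
  assumes "T \<in> lin S"
  shows "(\<lambda>\<omega>. r * T \<omega>) \<in> lin S"
proof -
  obtain f where f: "\<And>s. s \<in> S \<Longrightarrow> f s \<in> V s" "\<And>\<omega>. \<omega> \<in> space M \<Longrightarrow> T \<omega> = (\<Sum>s\<in>S. f s \<omega>)"
    using linE[OF assms(1)] by blast
  show ?thesis
    by (rule linI[of S "\<lambda>s \<omega>. r * f s \<omega>"]) (auto simp: f V_scale sum_distrib_left)
qed

lemma lin_sum:
  assumes "\<And>i. i \<in> I \<Longrightarrow> T i \<in> lin S"
  shows "(\<lambda>\<omega>. \<Sum>i\<in>I. T i \<omega>) \<in> lin S"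
  using assms
  by (induction I rule: infinite_finite_induct) (auto intro: lin_zero lin_add)

text \<open>The extra sources contribute 0. Finiteness of \<open>S'\<close> matters, as a sum over
  an infinite set is 0 by default.\<close>

lemma lin_mono:
  assumes "T \<in> lin S" "S \<subseteq> S'" "finite S'"
  shows "T \<in> lin S'"
proof -
  obtain f where f: "\<And>s. s \<in> S \<Longrightarrow> f s \<in> V s" "\<And>\<omega>. \<omega> \<in> space M \<Longrightarrow> T \<omega> = (\<Sum>s\<in>S. f s \<omega>)"
    using linE[OF assms(1)] by blast
  show ?thesis
  proof (rule linI[of S' "\<lambda>s. if s \<in> S then f s else (\<lambda>_. 0)"])
    fix \<omega> assume "\<omega> \<in> space M"
    then have "T \<omega> = (\<Sum>s\<in>S. f s \<omega>)" by (rule f(2))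
    also have "\<dots> = (\<Sum>s\<in>S. (if s \<in> S then f s else (\<lambda>_. 0)) \<omega>)"
      by (rule sum.cong) auto
    also have "\<dots> = (\<Sum>s\<in>S'. (if s \<in> S then f s else (\<lambda>_. 0)) \<omega>)"
      using assms(2,3) by (intro sum.mono_neutral_left) auto
    finally show "T \<omega> = (\<Sum>s\<in>S'. (if s \<in> S then f s else (\<lambda>_. 0)) \<omega>)" .
  qed (auto simp: f V_zero)
qed

lemma V_subset_lin:
  assumes "T \<in> V s" "s \<in> S" "finite S"
  shows "T \<in> lin S"
proof -
  have "T \<in> lin {s}" by (rule linI[of _ "\<lambda>_. T"]) (use assms in auto)
  then show ?thesis by (rule lin_mono) (use assms in auto)
qed

lemma indep_vars_V:
  assumes "\<And>s. s \<in> S \<Longrightarrow> f s \<in> V s"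
  shows "indep_vars (\<lambda>_. borel) f S"
  unfolding indep_vars_def2
proof (intro conjI ballI)
  fix s assume "s \<in> S"
  then show "random_variable borel (f s)"
    using V_normal[OF assms] by (auto simp: centered_normal_def)
next
  show "indep_sets (\<lambda>s. {f s -` A \<inter> space M | A. A \<in> sets borel}) S"
  proof (rule indep_sets_mono[OF indep])
    fix s assume "s \<in> S"
    then show "{f s -` A \<inter> space M | A. A \<in> sets borel} \<subseteq> sets (F s)"
      using measurable_sets[OF V_measurable[OF assms]] space_F by fastforce
  qed simp
qed

lemma V_facts:
  assumes "T \<in> V s"
  shows "T \<in> borel_measurable M" "integrable M (\<lambda>\<omega>. (T \<omega>)\<^sup>2)" "integrable M T" "expectation T = 0"
    "(\<integral>\<omega>. iexp (T \<omega>) \<partial>M) = of_real (exp (- (\<integral>\<omega>. (T \<omega>)\<^sup>2 \<partial>M) / 2))"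
proof -
  show 1: "T \<in> borel_measurable M" "integrable M (\<lambda>\<omega>. (T \<omega>)\<^sup>2)" "expectation T = 0"
    "(\<integral>\<omega>. iexp (T \<omega>) \<partial>M) = of_real (exp (- (\<integral>\<omega>. (T \<omega>)\<^sup>2 \<partial>M) / 2))"
    using V_normal[OF assms] unfolding centered_normal_def by blast+
  show "integrable M T" using 1(1,2) by (rule square_integrable_imp_integrable)
qed

lemma V_uncorrelated:
  assumes "T \<in> V s" "U \<in> V s'" "s \<noteq> s'"
  shows "expectation (\<lambda>\<omega>. T \<omega> * U \<omega>) = 0"
proof -
  define f where "f i = (if i = s then T else U)" for i
  have f: "f i \<in> V i" if "i \<in> {s, s'}" for i
    using that assms by (auto simp: f_def)
  have "expectation (\<lambda>\<omega>. \<Prod>i\<in>{s, s'}. f i \<omega>) = (\<Prod>i\<in>{s, s'}. expectation (f i))"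
    by (rule indep_vars_lebesgue_integral[OF _ indep_vars_V]) (simp, use f V_facts(3) in blast)+
  then show ?thesis
    using assms V_facts(4)[OF assms(1)] by (simp add: f_def)
qed

lemma lin_measurable:
  assumes "T \<in> lin S"
  shows "T \<in> borel_measurable M"
proof -
  obtain f where f: "\<And>s. s \<in> S \<Longrightarrow> f s \<in> V s" "\<And>\<omega>. \<omega> \<in> space M \<Longrightarrow> T \<omega> = (\<Sum>s\<in>S. f s \<omega>)"
    using linE[OF assms] by blast
  have "(\<lambda>\<omega>. \<Sum>s\<in>S. f s \<omega>) \<in> borel_measurable M"
    by (intro borel_measurable_sum V_facts(1)) (rule f(1))
  then show ?thesis by (simp add: f(2) cong: measurable_cong)
qed

lemma lin_product_integral:
  assumes f: "\<And>s. s \<in> S \<Longrightarrow> f s \<in> V s" "\<And>\<omega>. \<omega> \<in> space M \<Longrightarrow> T \<omega> = (\<Sum>s\<in>S. f s \<omega>)"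
    and g: "\<And>s. s \<in> S' \<Longrightarrow> g s \<in> V s" "\<And>\<omega>. \<omega> \<in> space M \<Longrightarrow> U \<omega> = (\<Sum>s\<in>S'. g s \<omega>)"
  shows "integrable M (\<lambda>\<omega>. T \<omega> * U \<omega>)"
    "expectation (\<lambda>\<omega>. T \<omega> * U \<omega>) = (\<Sum>s\<in>S. \<Sum>s'\<in>S'. expectation (\<lambda>\<omega>. f s \<omega> * g s' \<omega>))"
proof -
  have int: "integrable M (\<lambda>\<omega>. f s \<omega> * g s' \<omega>)" if "s \<in> S" "s' \<in> S'" for s s'
    using that f(1) g(1) by (intro integrable_mult_square_integrable V_facts(1,2)) auto
  have eq: "T \<omega> * U \<omega> = (\<Sum>s\<in>S. \<Sum>s'\<in>S'. f s \<omega> * g s' \<omega>)" if "\<omega> \<in> space M" for \<omega>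
    using that by (simp add: f g sum_product)
  show "integrable M (\<lambda>\<omega>. T \<omega> * U \<omega>)"
    by (subst Bochner_Integration.integrable_cong[OF refl eq])
       (auto intro!: Bochner_Integration.integrable_sum int)
  show "expectation (\<lambda>\<omega>. T \<omega> * U \<omega>) = (\<Sum>s\<in>S. \<Sum>s'\<in>S'. expectation (\<lambda>\<omega>. f s \<omega> * g s' \<omega>))"
    by (subst Bochner_Integration.integral_cong[OF refl eq])
       (auto simp: int Bochner_Integration.integral_sum Bochner_Integration.integrable_sum)
qed

lemma lin_mult_integrable:
  assumes "T \<in> lin S" "U \<in> lin S'"
  shows "integrable M (\<lambda>\<omega>. T \<omega> * U \<omega>)"
proof -
  obtain f where f: "\<And>s. s \<in> S \<Longrightarrow> f s \<in> V s" "\<And>\<omega>. \<omega> \<in> space M \<Longrightarrow> T \<omega> = (\<Sum>s\<in>S. f s \<omega>)"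
    using linE[OF assms(1)] by blast
  obtain g where g: "\<And>s. s \<in> S' \<Longrightarrow> g s \<in> V s" "\<And>\<omega>. \<omega> \<in> space M \<Longrightarrow> U \<omega> = (\<Sum>s\<in>S'. g s \<omega>)"
    using linE[OF assms(2)] by blast
  show ?thesis by (rule lin_product_integral(1)[OF f g])
qed

lemma lin_square_integrable:
  assumes "T \<in> lin S"
  shows "integrable M (\<lambda>\<omega>. (T \<omega>)\<^sup>2)"
  using lin_mult_integrable[OF assms assms] by (simp add: power2_eq_square)

lemma lin_integrable:
  assumes "T \<in> lin S"
  shows "integrable M T"
  using square_integrable_imp_integrable[OF lin_measurable lin_square_integrable] assms by blast

lemma lin_expectation:
  assumes "T \<in> lin S"
  shows "expectation T = 0"
proof -
  obtain f where f: "\<And>s. s \<in> S \<Longrightarrow> f s \<in> V s" "\<And>\<omega>. \<omega> \<in> space M \<Longrightarrow> T \<omega> = (\<Sum>s\<in>S. f s \<omega>)"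
    using linE[OF assms] by blast
  have "expectation T = expectation (\<lambda>\<omega>. \<Sum>s\<in>S. f s \<omega>)"
    by (intro Bochner_Integration.integral_cong f(2)) auto
  also have "\<dots> = 0"
    using V_facts(3,4)[OF f(1)] by (simp add: Bochner_Integration.integral_sum)
  finally show ?thesis .
qed

lemma lin_uncorrelated:
  assumes "T \<in> lin S" "U \<in> lin S'" "S \<inter> S' = {}"
  shows "expectation (\<lambda>\<omega>. T \<omega> * U \<omega>) = 0"
proof -
  obtain f where f: "\<And>s. s \<in> S \<Longrightarrow> f s \<in> V s" "\<And>\<omega>. \<omega> \<in> space M \<Longrightarrow> T \<omega> = (\<Sum>s\<in>S. f s \<omega>)"
    using linE[OF assms(1)] by blast
  obtain g where g: "\<And>s. s \<in> S' \<Longrightarrow> g s \<in> V s" "\<And>\<omega>. \<omega> \<in> space M \<Longrightarrow> U \<omega> = (\<Sum>s\<in>S'. g s \<omega>)"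
    using linE[OF assms(2)] by blast
  have "expectation (\<lambda>\<omega>. f s \<omega> * g s' \<omega>) = 0" if "s \<in> S" "s' \<in> S'" for s s'
    by (rule V_uncorrelated[OF f(1) g(1)]) (use that assms in auto)
  then show ?thesis using lin_product_integral(2)[OF f g] by simp
qed

text \<open>Independence makes the transforms of the summands multiply, and uncorrelatedness makes
  their variances add; the exponentials combine accordingly.\<close>

lemma lin_centered_normal:
  assumes "T \<in> lin S" and S: "finite S"
  shows "centered_normal M T"
proof -
  obtain f where f: "\<And>s. s \<in> S \<Longrightarrow> f s \<in> V s" "\<And>\<omega>. \<omega> \<in> space M \<Longrightarrow> T \<omega> = (\<Sum>s\<in>S. f s \<omega>)"
    using linE[OF assms(1)] by blast
  have "expectation (\<lambda>\<omega>. (T \<omega>)\<^sup>2) = (\<Sum>s\<in>S. \<Sum>s'\<in>S. expectation (\<lambda>\<omega>. f s \<omega> * f s' \<omega>))"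
    using lin_product_integral(2)[OF f f] by (simp add: power2_eq_square)
  also have "\<dots> = (\<Sum>s\<in>S. \<Sum>s'\<in>S. if s' = s then expectation (\<lambda>\<omega>. (f s \<omega>)\<^sup>2) else 0)"
    by (intro sum.cong refl) (auto simp: power2_eq_square intro!: V_uncorrelated f)
  finally have sq: "expectation (\<lambda>\<omega>. (T \<omega>)\<^sup>2) = (\<Sum>s\<in>S. expectation (\<lambda>\<omega>. (f s \<omega>)\<^sup>2))"
    using S by simp
  have "(\<integral>\<omega>. iexp (T \<omega>) \<partial>M) = (\<integral>\<omega>. (\<Prod>s\<in>S. iexp (f s \<omega>)) \<partial>M)"
    by (intro Bochner_Integration.integral_cong refl)
       (simp add: f exp_sum S sum_distrib_left of_real_sum)
  also have "\<dots> = (\<Prod>s\<in>S. \<integral>\<omega>. iexp (f s \<omega>) \<partial>M)"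
  proof (rule indep_vars_lebesgue_integral[OF S])
    show "indep_vars (\<lambda>_. borel) (\<lambda>s \<omega>. iexp (f s \<omega>)) S"
      by (rule indep_vars_compose2[OF indep_vars_V[of S f]]) (use f in auto)
    show "integrable M (\<lambda>\<omega>. iexp (f s \<omega>))" if "s \<in> S" for s
      by (rule integrable_iexp) (use V_facts(1) f that in auto)
  qed
  also have "\<dots> = (\<Prod>s\<in>S. of_real (exp (- (\<integral>\<omega>. (f s \<omega>)\<^sup>2 \<partial>M) / 2)))"
    by (intro prod.cong refl V_facts(5)) (erule f(1))
  also have "\<dots> = of_real (exp (- (\<integral>\<omega>. (T \<omega>)\<^sup>2 \<partial>M) / 2))"
    by (simp only: sq of_real_prod[symmetric] exp_sum[OF S, symmetric] sum_negf sum_divide_distrib[symmetric])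
  finally show ?thesis
    using lin_measurable lin_square_integrable lin_expectation assms
    by (auto simp: centered_normal_def)
qed

text \<open>Joint normality enters here: \<open>T + U\<close> lies in the same span, so its
  transform is exp(-Var/2), and for uncorrelated \<open>T\<close>, \<open>U\<close> the variance is
  additive.\<close>

lemma lin_iexp_product:
  assumes T: "T \<in> lin S" and U: "U \<in> lin S" and S: "finite S"
    and TU: "expectation (\<lambda>\<omega>. T \<omega> * U \<omega>) = 0"
  shows "(\<integral>\<omega>. iexp (T \<omega> + U \<omega>) \<partial>M) = (\<integral>\<omega>. iexp (T \<omega>) \<partial>M) * (\<integral>\<omega>. iexp (U \<omega>) \<partial>M)"
proof -
  have "expectation (\<lambda>\<omega>. (T \<omega> + U \<omega>)\<^sup>2)
      = expectation (\<lambda>\<omega>. (T \<omega>)\<^sup>2 + (U \<omega>)\<^sup>2 + 2 * (T \<omega> * U \<omega>))"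
    by (simp add: power2_sum mult.assoc)
  also have "\<dots> = expectation (\<lambda>\<omega>. (T \<omega>)\<^sup>2) + expectation (\<lambda>\<omega>. (U \<omega>)\<^sup>2)"
    using lin_square_integrable[OF T] lin_square_integrable[OF U] lin_mult_integrable[OF T U] TU
    by simp
  finally have "expectation (\<lambda>\<omega>. (T \<omega> + U \<omega>)\<^sup>2) = \<dots>" .
  then show ?thesis
    using lin_centered_normal[OF lin_add[OF T U] S] lin_centered_normal[OF T S]
      lin_centered_normal[OF U S]
    by (simp only: centered_normal_def of_real_mult[symmetric] exp_add[symmetric]) (simp add: add_divide_distrib)
qed

end

section \<open>Independence from past outputs\<close>

lemma sets_generated_by:
  "sets (generated_by M X) = {X -` A \<inter> space M | A. A \<in> sets borel}"
  unfolding generated_by_def by (rule sets_vimage_algebra2) auto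

lemma space_generated_by [simp]: "space (generated_by M X) = space M"
  by (simp add: generated_by_def)

lemma subalgebra_generated_by:
  assumes "X \<in> borel_measurable M"
  shows "subalgebra M (generated_by M X)"
  using assms by (auto simp: subalgebra_def sets_generated_by)

lemma measurable_generated_by: "X \<in> borel_measurable (generated_by M X)"
  unfolding generated_by_def by (rule measurable_vimage_algebra1) auto

lemma space_past_outputs [simp]: "space (past_outputs M y k) = space M"
  by (simp add: past_outputs_def space_measure_of_conv)

lemma sets_past_outputs:
  "sets (past_outputs M y k) = sigma_sets (space M) (\<Union>j<k. sets (generated_by M (y j)))"
  unfolding past_outputs_def by (intro sets_measure_of) (auto simp: sets_generated_by)

lemma measurable_past_outputs:
  assumes "j < k"
  shows "y j \<in> borel_measurable (past_outputs M y k)"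
proof (rule measurableI)
  fix A :: "(real ^ 'b) set" assume "A \<in> sets borel"
  then show "y j -` A \<inter> space (past_outputs M y k) \<in> sets (past_outputs M y k)"
    using assms by (auto simp: sets_past_outputs sets_generated_by intro!: sigma_sets.Basic bexI[of _ j])
qed auto

lemma past_outputs_least:
  assumes "\<And>j. j < k \<Longrightarrow> y j \<in> borel_measurable N" and "space N = space M"
  shows "sets (past_outputs M y k) \<subseteq> sets N"
  unfolding sets_past_outputs assms(2)[symmetric]
proof (rule sets.sigma_sets_subset, rule subsetI)
  fix X assume "X \<in> (\<Union>j<k. sets (generated_by M (y j)))"
  then obtain j A where "j < k" "A \<in> sets borel" "X = y j -` A \<inter> space M"
    by (auto simp: sets_generated_by)
  then show "X \<in> sets N" using measurable_sets[OF assms(1)] by (simp add: assms(2)[symmetric])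
qed

lemma subalgebra_past_outputs:
  assumes "\<And>j. j < k \<Longrightarrow> y j \<in> borel_measurable M"
  shows "subalgebra M (past_outputs M y k)"
  using past_outputs_least[OF assms] by (auto simp: subalgebra_def)

lemma past_outputs_mono:
  assumes "j \<le> k"
  shows "sets (past_outputs M y j) \<subseteq> sets (past_outputs M y k)"
  using assms by (intro past_outputs_least measurable_past_outputs) auto

text \<open>Fourier uniqueness for a varying number of vectors, obtained one variable at a time: the
  newest variable is first carried along as a character in the weight, then resolved by the
  uniqueness theorem for \<open>z k\<close> alone.\<close>

lemma set_integral_zero_past_outputs:
  fixes z :: "nat \<Rightarrow> 'a \<Rightarrow> real ^ 'p"
  assumes "integrable M \<Phi>" and "\<And>j. j < k \<Longrightarrow> z j \<in> borel_measurable M"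
    and "\<And>t. (\<integral>\<omega>. \<Phi> \<omega> * iexp (\<Sum>j<k. t j \<bullet> z j \<omega>) \<partial>M) = 0"
    and "B \<in> sets (past_outputs M z k)"
  shows "(LINT \<omega>:B|M. \<Phi> \<omega>) = 0"
  using assms
proof (induction k arbitrary: \<Phi> B)
  case 0
  show ?case
    by (rule set_integral_zero_sigma_sets[of M \<Phi> "{}"])
       (use 0 in \<open>auto simp: sets_past_outputs Int_stable_def\<close>)
next
  case (Suc k)
  have [measurable]: "z k \<in> borel_measurable M" and [measurable]: "\<Phi> \<in> borel_measurable M"
    using Suc.prems(1,2) by auto
  have sub: "sets (past_outputs M z k) \<subseteq> sets M"
    using subalgebra_past_outputs[of k z M] Suc.prems(2) by (auto simp: subalgebra_def)
  \<comment> \<open>With \<open>s\<close> fixed the induction hypothesis sees only the first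
    \<open>k\<close> variables; \<open>t(k := s)\<close> is the joint frequency at which the premise
    is used. Varying \<open>s\<close> afterwards says that \<open>indicator D\<close> times
    \<open>\<Phi>\<close> has zero transform in \<open>z k\<close>.\<close>
  have step: "(LINT \<omega>:D|M. \<Phi> \<omega> * iexp (s \<bullet> z k \<omega>)) = 0"
    if "D \<in> sets (past_outputs M z k)" for s D
  proof (rule Suc.IH[OF _ _ _ that])
    show "integrable M (\<lambda>\<omega>. \<Phi> \<omega> * iexp (s \<bullet> z k \<omega>))"
      using Suc.prems(1) by (rule integrable_mult_iexp) measurable
    show "(\<integral>\<omega>. \<Phi> \<omega> * iexp (s \<bullet> z k \<omega>) * iexp (\<Sum>j<k. t j \<bullet> z j \<omega>) \<partial>M) = 0" for t
    proof -
      have "(\<Sum>j<Suc k. (t(k := s)) j \<bullet> z j \<omega>) = s \<bullet> z k \<omega> + (\<Sum>j<k. t j \<bullet> z j \<omega>)" for \<omega>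
        by simp
      then have "\<Phi> \<omega> * iexp (\<Sum>j<Suc k. (t(k := s)) j \<bullet> z j \<omega>)
          = \<Phi> \<omega> * iexp (s \<bullet> z k \<omega>) * iexp (\<Sum>j<k. t j \<bullet> z j \<omega>)" for \<omega>
        by (simp only: of_real_add distrib_left exp_add mult.assoc)
      then show ?thesis using Suc.prems(3)[of "t(k := s)"] by (simp only:)
    qed
  qed (use Suc.prems(2) in auto)
  have rect: "(LINT \<omega>:(D \<inter> (z k -` C \<inter> space M))|M. \<Phi> \<omega>) = 0"
    if D: "D \<in> sets (past_outputs M z k)" and C: "C \<in> sets borel" for D C
  proof -
    have "D \<in> sets M" using D sub by auto
    then have int: "integrable M (\<lambda>\<omega>. indicator D \<omega> *\<^sub>R \<Phi> \<omega>)"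
      using Suc.prems(1) by (rule integrable_mult_indicator)
    have "(\<lambda>\<omega>. indicator D \<omega> *\<^sub>R \<Phi> \<omega>) \<in> fourier_null M (z k)"
      using step[OF D] int by (simp add: fourier_null_def set_lebesgue_integral_def)
    from set_integral_zero_fourier[OF _ this C] show ?thesis
      by (simp add: set_lebesgue_integral_def indicator_inter_arith mult.commute)
  qed
  \<comment> \<open>Rectangles: an event of the earlier variables met with an event of
    \<open>z k\<close>. They are intersection-stable and contain every generator of the new
    sigma-algebra.\<close>
  define G where "G = (\<lambda>(D, C). D \<inter> (z k -` C \<inter> space M)) ` (sets (past_outputs M z k) \<times> sets borel)"
  have top: "space M \<in> sets (past_outputs M z k)"
    using sets.top[of "past_outputs M z k"] by simp
  show ?case
  proof (rule set_integral_zero_sigma_sets[of M \<Phi> G])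
    show "Int_stable G"
      unfolding Int_stable_def
    proof (intro ballI)
      fix a b assume "a \<in> G" "b \<in> G"
      then obtain D C D' C' where *: "D \<in> sets (past_outputs M z k)" "C \<in> sets borel"
        "a = D \<inter> (z k -` C \<inter> space M)" "D' \<in> sets (past_outputs M z k)" "C' \<in> sets borel"
        "b = D' \<inter> (z k -` C' \<inter> space M)" by (auto simp: G_def)
      then show "a \<inter> b \<in> G"
        unfolding G_def by (intro image_eqI[of _ _ "(D \<inter> D', C \<inter> C')"]) auto
    qed
    show "G \<subseteq> sets M"
      using sub by (auto simp: G_def intro!: sets.Int measurable_sets[of "z k"])
    show "(LINT \<omega>:D|M. \<Phi> \<omega>) = 0" if "D \<in> G" for D
      using that rect by (auto simp: G_def)
    show "(\<integral>\<omega>. \<Phi> \<omega> \<partial>M) = 0"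
      using Suc.prems(3)[of "\<lambda>_. 0"] by simp
    have "y \<in> sigma_sets (space M) G" if "y \<in> (\<Union>j<Suc k. sets (generated_by M (z j)))" for y
    proof -
      obtain j C where j: "j < Suc k" "C \<in> sets borel" "y = z j -` C \<inter> space M"
        using \<open>y \<in> _\<close> by (auto simp: sets_generated_by)
      have "y \<in> G"
      proof (cases "j = k")
        case True
        then show ?thesis
          unfolding G_def using top j by (intro image_eqI[of _ _ "(space M, C)"]) auto
      next
        case False
        then have "y \<in> sets (past_outputs M z k)"
          using measurable_sets[OF measurable_past_outputs[of j k z M] j(2)] j by auto
        then show ?thesis
          unfolding G_def using j by (intro image_eqI[of _ _ "(y, UNIV)"]) auto
      qed
      then show ?thesis by (rule sigma_sets.Basic)
    qed
    then have "sigma_sets (space M) (\<Union>j<Suc k. sets (generated_by M (z j))) \<subseteq> sigma_sets (space M) G"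
      by (intro sigma_sets_mono subsetI)
    then show "B \<in> sigma_sets (space M) G"
      using Suc.prems(4) unfolding sets_past_outputs by (rule subsetD)
  qed (use Suc.prems in auto)
qed

section \<open>From factored characteristic functions to independence and conditional
  expectations\<close>

context prob_space
begin

text \<open>Fourier uniqueness is applied twice: in the variables \<open>z j\<close> it yields
  E[1_B exp(i s.Z)] = P(B) E[exp(i s.Z)] for every \<open>s\<close>, and then in \<open>Z\<close> it
  replaces the exponential by an indicator.\<close>

lemma prob_Int_past_outputs:
  fixes z :: "nat \<Rightarrow> 'a \<Rightarrow> real ^ 'p" and Z :: "'a \<Rightarrow> real ^ 'q"
  assumes z: "\<And>j. j < k \<Longrightarrow> z j \<in> borel_measurable M" and Z[measurable]: "Z \<in> borel_measurable M"
    and factor: "\<And>s t. (\<integral>\<omega>. iexp (s \<bullet> Z \<omega> + (\<Sum>j<k. t j \<bullet> z j \<omega>)) \<partial>M)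
        = (\<integral>\<omega>. iexp (s \<bullet> Z \<omega>) \<partial>M) * (\<integral>\<omega>. iexp (\<Sum>j<k. t j \<bullet> z j \<omega>) \<partial>M)"
    and B: "B \<in> sets (past_outputs M z k)" and C: "C \<in> sets borel"
  shows "prob (B \<inter> (Z -` C \<inter> space M)) = prob B * prob (Z -` C \<inter> space M)"
proof -
  define ch where "ch s = (\<integral>\<omega>. iexp (s \<bullet> Z \<omega>) \<partial>M)" for s
  have BM: "B \<in> sets M"
    using subalgebra_past_outputs[of k z M] z B by (auto simp: subalgebra_def)
  have int: "integrable M (\<lambda>\<omega>. iexp (f \<omega>))" if "f \<in> borel_measurable M" for f :: "'a \<Rightarrow> real"
    by (rule integrable_iexp) (use that in auto)
  have intB: "integrable M (\<lambda>\<omega>. indicator B \<omega> *\<^sub>R f \<omega>)" if "integrable M f" for f :: "'a \<Rightarrow> complex"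
    by (rule integrable_mult_indicator[OF BM that])
  \<comment> \<open>Subtracting \<open>ch s\<close> turns the factorisation into a vanishing
    transform in the past variables.\<close>
  have set0: "(LINT \<omega>:B|M. iexp (s \<bullet> Z \<omega>) - ch s) = 0" for s
  proof (rule set_integral_zero_past_outputs[OF _ z _ B])
    show "integrable M (\<lambda>\<omega>. iexp (s \<bullet> Z \<omega>) - ch s)" using int[of "\<lambda>\<omega>. s \<bullet> Z \<omega>"] by simp
    fix t
    have [measurable]: "(\<lambda>\<omega>. \<Sum>j<k. t j \<bullet> z j \<omega>) \<in> borel_measurable M"
      by (intro borel_measurable_sum borel_measurable_inner borel_measurable_const z) auto
    have "(\<integral>\<omega>. (iexp (s \<bullet> Z \<omega>) - ch s) * iexp (\<Sum>j<k. t j \<bullet> z j \<omega>) \<partial>M)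
        = (\<integral>\<omega>. iexp (s \<bullet> Z \<omega> + (\<Sum>j<k. t j \<bullet> z j \<omega>)) - ch s * iexp (\<Sum>j<k. t j \<bullet> z j \<omega>) \<partial>M)"
      by (intro Bochner_Integration.integral_cong refl) (simp only: left_diff_distrib of_real_add distrib_left exp_add)
    also have "\<dots> = 0"
      using factor[of s t] int[of "\<lambda>\<omega>. s \<bullet> Z \<omega> + (\<Sum>j<k. t j \<bullet> z j \<omega>)"]
        int[of "\<lambda>\<omega>. \<Sum>j<k. t j \<bullet> z j \<omega>"]
      by (subst Bochner_Integration.integral_diff) (auto simp: ch_def simp del: of_real_add of_real_sum)
    finally show "(\<integral>\<omega>. (iexp (s \<bullet> Z \<omega>) - ch s) * iexp (\<Sum>j<k. t j \<bullet> z j \<omega>) \<partial>M) = 0" .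
  qed
  \<comment> \<open>By the first application, this centred indicator has zero transform in
    \<open>Z\<close>.\<close>
  define \<Psi> where "\<Psi> \<omega> = complex_of_real (indicator B \<omega> - prob B)" for \<omega>
  have intI: "integrable M (indicator B :: 'a \<Rightarrow> real)" using BM by (simp add: integrable_indicator_iff emeasure_eq_measure)
  have "\<Psi> \<in> fourier_null M Z"
  proof -
    have "(\<integral>\<omega>. \<Psi> \<omega> * iexp (t \<bullet> Z \<omega>) \<partial>M) = 0" for t
    proof -
      have "(\<integral>\<omega>. indicator B \<omega> *\<^sub>R iexp (t \<bullet> Z \<omega>) \<partial>M) = (\<integral>\<omega>. indicator B \<omega> *\<^sub>R ch t \<partial>M)"
        using set0[of t] intB[OF int, of "\<lambda>\<omega>. t \<bullet> Z \<omega>"] intB[of "\<lambda>_. ch t"]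
        by (simp add: set_lebesgue_integral_def scaleR_diff_right)
      also have "\<dots> = prob B *\<^sub>R ch t" using BM intI by simp
      finally have *: "(\<integral>\<omega>. indicator B \<omega> *\<^sub>R iexp (t \<bullet> Z \<omega>) \<partial>M) = prob B *\<^sub>R ch t" .
      have "(\<integral>\<omega>. \<Psi> \<omega> * iexp (t \<bullet> Z \<omega>) \<partial>M)
          = (\<integral>\<omega>. indicator B \<omega> *\<^sub>R iexp (t \<bullet> Z \<omega>) - prob B *\<^sub>R iexp (t \<bullet> Z \<omega>) \<partial>M)"
        by (intro Bochner_Integration.integral_cong refl)
           (simp add: \<Psi>_def scaleR_conv_of_real left_diff_distrib)
      also have "\<dots> = 0"
        using intB[OF int, of "\<lambda>\<omega>. t \<bullet> Z \<omega>"] int[of "\<lambda>\<omega>. t \<bullet> Z \<omega>"] *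
        by (simp add: ch_def)
      finally show ?thesis .
    qed
    moreover have "integrable M \<Psi>" unfolding \<Psi>_def using intI by (intro integrable_of_real) simp
    ultimately show ?thesis by (simp add: fourier_null_def)
  qed
  from set_integral_zero_fourier[OF Z this C]
  have "(\<integral>\<omega>. indicator (Z -` C \<inter> space M) \<omega> *\<^sub>R complex_of_real (indicator B \<omega> - prob B) \<partial>M) = 0"
    by (simp add: set_lebesgue_integral_def \<Psi>_def)
  then have "(\<integral>\<omega>. complex_of_real (indicator (B \<inter> (Z -` C \<inter> space M)) \<omega>
      - prob B * indicator (Z -` C \<inter> space M) \<omega>) \<partial>M) = 0"
    by (simp add: scaleR_conv_of_real indicator_inter_arith algebra_simps)
  then have "(\<integral>\<omega>. indicator (B \<inter> (Z -` C \<inter> space M)) \<omega>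
      - prob B * indicator (Z -` C \<inter> space M) \<omega> \<partial>M) = 0"
    by (simp only: integral_complex_of_real of_real_eq_0_iff)
  moreover have "Z -` C \<inter> space M \<in> sets M" using C by measurable
  ultimately show ?thesis
    using BM by (simp add: emeasure_eq_measure integrable_indicator_iff)
qed

text \<open>Tested against \<open>A\<close> in \<open>G\<close>, the integral factors because
  \<open>indicator A\<close> and \<open>f \<circ> Z\<close> are independent. The premise concerns
  events of \<open>Z\<close>, and those of \<open>f \<circ> Z\<close> are among them.\<close>

lemma real_cond_exp_indep:
  fixes Z :: "'a \<Rightarrow> 'c::topological_space" and f :: "'c \<Rightarrow> real"
  assumes G: "subalgebra M G" and Z[measurable]: "Z \<in> borel_measurable M"
    and f[measurable]: "f \<in> borel_measurable borel" and int: "integrable M (\<lambda>\<omega>. f (Z \<omega>))"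
    and indep: "\<And>B C. B \<in> sets G \<Longrightarrow> C \<in> sets borel \<Longrightarrow>
        prob (B \<inter> (Z -` C \<inter> space M)) = prob B * prob (Z -` C \<inter> space M)"
  shows "AE \<omega> in M. real_cond_exp M G (\<lambda>\<omega>. f (Z \<omega>)) \<omega> = expectation (\<lambda>\<omega>. f (Z \<omega>))"
proof -
  interpret G: finite_measure_subalgebra M G
    by unfold_locales (rule G)
  have space_G: "space G = space M" and sub: "sets G \<subseteq> sets M" using G by (auto simp: subalgebra_def)
  have ind: "indep_var borel (\<lambda>\<omega>. indicator A \<omega> :: real) borel (\<lambda>\<omega>. f (Z \<omega>))" if A: "A \<in> sets G" for A
    unfolding indep_var_eq
  proof (intro conjI indep_setI)
    have "A \<in> sets M" using A sub by auto
    then show "(\<lambda>\<omega>. indicator A \<omega> :: real) \<in> borel_measurable M" by measurable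
    have "sigma_sets (space G) {(\<lambda>\<omega>. indicator A \<omega> :: real) -` C \<inter> space G | C. C \<in> sets borel} \<subseteq> sets G"
      using A by (intro sets.sigma_sets_subset) (auto intro: measurable_sets)
    then have 1: "sigma_sets (space M) {(\<lambda>\<omega>. indicator A \<omega> :: real) -` C \<inter> space M | C. C \<in> sets borel} \<subseteq> sets G"
      by (simp only: space_G)
    have fZ: "(\<lambda>\<omega>. f (Z \<omega>)) \<in> borel_measurable (generated_by M Z)"
      using measurable_generated_by f by (rule measurable_compose)
    have "sigma_sets (space (generated_by M Z)) {(\<lambda>\<omega>. f (Z \<omega>)) -` C \<inter> space (generated_by M Z) | C. C \<in> sets borel}
        \<subseteq> sets (generated_by M Z)"
      using measurable_sets[OF fZ] by (intro sets.sigma_sets_subset) auto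
    then have 2: "sigma_sets (space M) {(\<lambda>\<omega>. f (Z \<omega>)) -` C \<inter> space M | C. C \<in> sets borel}
        \<subseteq> sets (generated_by M Z)"
      by simp
    show "sigma_sets (space M) {(\<lambda>\<omega>. indicator A \<omega> :: real) -` C \<inter> space M | C. C \<in> sets borel} \<subseteq> events"
      using 1 sub by (rule order_trans)
    show "sigma_sets (space M) {(\<lambda>\<omega>. f (Z \<omega>)) -` C \<inter> space M | C. C \<in> sets borel} \<subseteq> events"
      using 2 subalgebra_generated_by[OF Z] by (simp add: subalgebra_def)
    fix a b
    assume "a \<in> sigma_sets (space M) {(\<lambda>\<omega>. indicator A \<omega> :: real) -` C \<inter> space M | C. C \<in> sets borel}"
      and "b \<in> sigma_sets (space M) {(\<lambda>\<omega>. f (Z \<omega>)) -` C \<inter> space M | C. C \<in> sets borel}"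
    then have a: "a \<in> sets G" and b: "b \<in> sets (generated_by M Z)"
      using 1 2 by (auto dest: subsetD)
    from b obtain C where "C \<in> sets borel" "b = Z -` C \<inter> space M"
      by (auto simp: sets_generated_by)
    then show "prob (a \<inter> b) = prob a * prob b" using indep[OF a] by simp
  qed measurable
  show ?thesis
  proof (rule G.real_cond_exp_charact)
    fix A assume A: "A \<in> sets G"
    then have AM: "A \<in> sets M" using sub by auto
    have "integrable M (indicator A :: 'a \<Rightarrow> real)" using AM by (simp add: integrable_indicator_iff emeasure_eq_measure)
    then have "(\<integral>\<omega>. indicator A \<omega> * f (Z \<omega>) \<partial>M) = prob A * expectation (\<lambda>\<omega>. f (Z \<omega>))"
      using indep_var_lebesgue_integral[OF ind[OF A]] int AM by simp
    then show "(LINT \<omega>:A|M. f (Z \<omega>)) = (LINT \<omega>:A|M. expectation (\<lambda>\<omega>. f (Z \<omega>)))"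
      using AM by (simp add: set_lebesgue_integral_def)
  qed (use int in auto)
qed

end

section \<open>Second moments of random vectors\<close>

lemma integrable_vec_lambda:
  fixes f :: "'a \<Rightarrow> 'b::euclidean_space ^ 'n"
  assumes "\<And>i. integrable M (\<lambda>\<omega>. f \<omega> $ i)"
  shows "integrable M f"
proof -
  have "linear (axis i :: 'b \<Rightarrow> 'b ^ 'n)" for i
    by (auto simp: linear_iff axis_def vec_eq_iff)
  then have "integrable M (\<lambda>\<omega>. axis i (f \<omega> $ i))" for i
    using assms by (intro integrable_bounded_linear[of "axis i"]) (auto simp: linear_conv_bounded_linear)
  then have "integrable M (\<lambda>\<omega>. \<Sum>i\<in>UNIV. axis i (f \<omega> $ i))" by simp
  moreover have "(\<Sum>i\<in>UNIV. axis i (a $ i)) = a" for a :: "'b ^ 'n"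
    by (simp add: vec_eq_iff axis_def if_distrib sum.delta cong: if_cong)
  ultimately show ?thesis by simp
qed

lemma outer_product_add:
  "outer_product (a + a') b = outer_product a b + outer_product a' b"
  "outer_product a (b + b') = outer_product a b + outer_product a b'"
  by (simp_all add: outer_product_def vec_eq_iff algebra_simps)

lemma outer_product_diff:
  "outer_product (a - a') b = outer_product a b - outer_product a' b"
  "outer_product a (b - b') = outer_product a b - outer_product a b'"
  by (simp_all add: outer_product_def vec_eq_iff algebra_simps)

lemma outer_product_mult_left: "outer_product (A *v a) b = A ** outer_product a b"
  by (simp add: outer_product_def vec_eq_iff matrix_vector_mult_def matrix_matrix_mult_def
      sum_distrib_right mult.assoc)

lemma transpose_outer_product: "transpose (outer_product a b) = outer_product b a"
  by (simp add: outer_product_def transpose_def vec_eq_iff mult.commute)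

lemma trace_outer_product: "trace (outer_product a a) = (norm a)\<^sup>2"
  by (simp add: trace_def outer_product_def power2_norm_eq_inner inner_vec_def)

lemma bounded_linear_matrix_mult_left: "bounded_linear (\<lambda>X :: real ^ 'k ^ 'n. (A :: real ^ 'n ^ 'm) ** X)"
  unfolding linear_conv_bounded_linear[symmetric] linear_iff
  by (auto simp: matrix_add_ldistrib matrix_matrix_mult_def vec_eq_iff sum_distrib_left
      algebra_simps sum.distrib)

lemma bounded_linear_transpose: "bounded_linear (transpose :: real ^ 'n ^ 'm \<Rightarrow> real ^ 'm ^ 'n)"
  unfolding linear_conv_bounded_linear[symmetric] linear_iff
  by (auto simp: transpose_def vec_eq_iff)

lemma bounded_linear_trace: "bounded_linear (trace :: real ^ 'n ^ 'n \<Rightarrow> real)"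
  unfolding linear_conv_bounded_linear[symmetric] linear_iff
  by (auto simp: trace_def sum.distrib sum_distrib_left)

text \<open>The matrix E[X Y^T], a cross-covariance for centred vectors. Integrals of non-integrable
  functions default to 0, hence the integrability premises in the rules that follow.\<close>

definition moment :: "'a measure \<Rightarrow> ('a \<Rightarrow> real ^ 'n) \<Rightarrow> ('a \<Rightarrow> real ^ 'm) \<Rightarrow> real ^ 'm ^ 'n" where
  "moment M X Y = (\<integral>\<omega>. outer_product (X \<omega>) (Y \<omega>) \<partial>M)"

lemma transpose_moment:
  assumes "integrable M (\<lambda>\<omega>. outer_product (X \<omega>) (Y \<omega>))"
  shows "transpose (moment M X Y) = moment M Y X"
  unfolding moment_def
  by (subst integral_bounded_linear[OF bounded_linear_transpose assms, symmetric])
     (simp add: transpose_outer_product)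

lemma moment_mult_left:
  assumes "integrable M (\<lambda>\<omega>. outer_product (X \<omega>) (Y \<omega>))"
  shows "moment M (\<lambda>\<omega>. A *v X \<omega>) Y = A ** moment M X Y"
  unfolding moment_def outer_product_mult_left
  by (rule integral_bounded_linear[OF bounded_linear_matrix_mult_left assms])

text \<open>Transposition exchanges the two arguments and reduces this to left
  multiplication.\<close>

lemma moment_mult_right:
  assumes "integrable M (\<lambda>\<omega>. outer_product (X \<omega>) (Y \<omega>))"
  shows "moment M X (\<lambda>\<omega>. A *v Y \<omega>) = moment M X Y ** transpose A"
proof -
  have "integrable M (\<lambda>\<omega>. transpose (outer_product (X \<omega>) (Y \<omega>)))"
    by (rule integrable_bounded_linear[OF bounded_linear_transpose assms])
  then have int: "integrable M (\<lambda>\<omega>. outer_product (Y \<omega>) (X \<omega>))"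
    by (simp add: transpose_outer_product)
  then have int2: "integrable M (\<lambda>\<omega>. outer_product (A *v Y \<omega>) (X \<omega>))"
    unfolding outer_product_mult_left by (rule integrable_bounded_linear[OF bounded_linear_matrix_mult_left])
  show ?thesis
    using moment_mult_left[OF int, of A] transpose_moment[OF int] transpose_moment[OF int2]
    by (simp add: matrix_transpose_mul)
qed

lemma moment_add:
  assumes "integrable M (\<lambda>\<omega>. outer_product (X \<omega>) (Y \<omega>))"
    "integrable M (\<lambda>\<omega>. outer_product (X' \<omega>) (Y \<omega>))"
  shows "moment M (\<lambda>\<omega>. X \<omega> + X' \<omega>) Y = moment M X Y + moment M X' Y"
  using assms by (simp add: moment_def outer_product_add)

lemma moment_add_right:
  assumes "integrable M (\<lambda>\<omega>. outer_product (X \<omega>) (Y \<omega>))"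
    "integrable M (\<lambda>\<omega>. outer_product (X \<omega>) (Y' \<omega>))"
  shows "moment M X (\<lambda>\<omega>. Y \<omega> + Y' \<omega>) = moment M X Y + moment M X Y'"
  using assms by (simp add: moment_def outer_product_add)

lemma moment_diff:
  assumes "integrable M (\<lambda>\<omega>. outer_product (X \<omega>) (Y \<omega>))"
    "integrable M (\<lambda>\<omega>. outer_product (X' \<omega>) (Y \<omega>))"
  shows "moment M (\<lambda>\<omega>. X \<omega> - X' \<omega>) Y = moment M X Y - moment M X' Y"
  using assms by (simp add: moment_def outer_product_diff)

lemma moment_diff_right:
  assumes "integrable M (\<lambda>\<omega>. outer_product (X \<omega>) (Y \<omega>))"
    "integrable M (\<lambda>\<omega>. outer_product (X \<omega>) (Y' \<omega>))"
  shows "moment M X (\<lambda>\<omega>. Y \<omega> - Y' \<omega>) = moment M X Y - moment M X Y'"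
  using assms by (simp add: moment_def outer_product_diff)

lemma moment_cong:
  assumes "\<And>\<omega>. \<omega> \<in> space M \<Longrightarrow> X \<omega> = X' \<omega>" "\<And>\<omega>. \<omega> \<in> space M \<Longrightarrow> Y \<omega> = Y' \<omega>"
  shows "moment M X Y = moment M X' Y'"
  unfolding moment_def by (intro Bochner_Integration.integral_cong) (auto simp: assms)

lemma trace_moment:
  assumes "integrable M (\<lambda>\<omega>. outer_product (X \<omega>) (X \<omega>))"
  shows "trace (moment M X X) = (\<integral>\<omega>. (norm (X \<omega>))\<^sup>2 \<partial>M)"
  unfolding moment_def
  by (subst integral_bounded_linear[OF bounded_linear_trace assms, symmetric])
     (simp add: trace_outer_product)

section \<open>Random vectors that are linear in the sources\<close>

context gaussian_sources
begin

text \<open>Quantifying over all functionals, and not just coordinates, makes stability under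
  matrices immediate: a functional of A X is another functional of X.\<close>

definition vlin :: "'i set \<Rightarrow> ('a \<Rightarrow> real ^ 'n) \<Rightarrow> bool" where
  "vlin S X \<longleftrightarrow> (\<forall>a. (\<lambda>\<omega>. a \<bullet> X \<omega>) \<in> lin S)"

lemma vlin_cong:
  assumes "vlin S X" "\<And>\<omega>. \<omega> \<in> space M \<Longrightarrow> Y \<omega> = X \<omega>"
  shows "vlin S Y"
  using assms unfolding vlin_def by (metis (no_types, lifting) lin_cong)

lemma vlin_add: "vlin S X \<Longrightarrow> vlin S Y \<Longrightarrow> vlin S (\<lambda>\<omega>. X \<omega> + Y \<omega>)"
  by (auto simp: vlin_def inner_add_right intro: lin_add)

lemma vlin_mult:
  assumes "vlin S X"
  shows "vlin S (\<lambda>\<omega>. A *v X \<omega>)"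
  using assms by (simp add: vlin_def flip: dot_lmul_matrix)

lemma vlin_diff:
  assumes "vlin S X" "vlin S Y"
  shows "vlin S (\<lambda>\<omega>. X \<omega> - Y \<omega>)"
  unfolding vlin_def
proof
  fix a
  have "(\<lambda>\<omega>. a \<bullet> X \<omega> + (- 1) * (a \<bullet> Y \<omega>)) \<in> lin S"
    using assms by (intro lin_add lin_scale) (auto simp: vlin_def)
  then show "(\<lambda>\<omega>. a \<bullet> (X \<omega> - Y \<omega>)) \<in> lin S"
    by (simp add: inner_diff_right)
qed

lemma vlin_mono: "vlin S X \<Longrightarrow> S \<subseteq> S' \<Longrightarrow> finite S' \<Longrightarrow> vlin S' X"
  by (auto simp: vlin_def intro: lin_mono)

lemma vlin_component:
  assumes "vlin S X"
  shows "(\<lambda>\<omega>. X \<omega> $ i) \<in> lin S"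
proof -
  have "(\<lambda>\<omega>. axis i 1 \<bullet> X \<omega>) \<in> lin S" using assms by (auto simp: vlin_def)
  then show ?thesis by (simp add: inner_axis')
qed

lemma vlin_integrable: "vlin S X \<Longrightarrow> integrable M X"
  by (intro integrable_vec_lambda lin_integrable vlin_component)

lemma vlin_expectation:
  assumes "vlin S X"
  shows "expectation X = 0"
proof -
  have "expectation X $ i = 0" for i
    using lin_expectation[OF vlin_component[OF assms, of i]]
      integral_bounded_linear[OF bounded_linear_vec_nth vlin_integrable[OF assms], of i] by simp
  then show ?thesis by (simp add: vec_eq_iff)
qed

lemma vlin_outer_integrable:
  assumes "vlin S X" "vlin S' Y"
  shows "integrable M (\<lambda>\<omega>. outer_product (X \<omega>) (Y \<omega>))"
  using lin_mult_integrable[OF vlin_component[OF assms(1)] vlin_component[OF assms(2)]]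
  by (intro integrable_vec_lambda) (simp add: outer_product_def)

lemma moment_component:
  assumes "vlin S X" "vlin S' Y"
  shows "moment M X Y $ i $ j = expectation (\<lambda>\<omega>. X \<omega> $ i * Y \<omega> $ j)"
proof -
  have "bounded_linear (\<lambda>A :: real ^ 'c ^ 'b. A $ i $ j)"
    by (intro bounded_linear_compose[OF bounded_linear_vec_nth bounded_linear_vec_nth])
  from integral_bounded_linear[OF this vlin_outer_integrable[OF assms]]
  show ?thesis by (simp add: moment_def outer_product_def)
qed

lemma moment_eq_0:
  assumes "vlin S X" "vlin S' Y" "S \<inter> S' = {}"
  shows "moment M X Y = 0"
  using lin_uncorrelated[OF vlin_component[OF assms(1)] vlin_component[OF assms(2)] assms(3)]
  by (simp add: vec_eq_iff moment_component[OF assms(1,2)])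

lemma inner_moment:
  assumes "vlin S X" "vlin S' Y"
  shows "expectation (\<lambda>\<omega>. (a \<bullet> X \<omega>) * (b \<bullet> Y \<omega>)) = a \<bullet> (moment M X Y *v b)"
proof -
  note int = lin_mult_integrable[OF vlin_component[OF assms(1)] vlin_component[OF assms(2)]]
  have "expectation (\<lambda>\<omega>. (a \<bullet> X \<omega>) * (b \<bullet> Y \<omega>))
      = expectation (\<lambda>\<omega>. \<Sum>i\<in>UNIV. \<Sum>j\<in>UNIV. a $ i * b $ j * (X \<omega> $ i * Y \<omega> $ j))"
    by (simp add: inner_vec_def sum_product mult_ac)
  also have "\<dots> = (\<Sum>i\<in>UNIV. \<Sum>j\<in>UNIV. a $ i * b $ j * expectation (\<lambda>\<omega>. X \<omega> $ i * Y \<omega> $ j))"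
    using int by (simp add: Bochner_Integration.integral_sum)
  also have "\<dots> = a \<bullet> (moment M X Y *v b)"
    by (simp add: inner_vec_def matrix_vector_mult_def moment_component[OF assms] sum_distrib_left mult_ac)
  finally show ?thesis .
qed

end

section \<open>The innovations of the Kalman filter\<close>

lemma borel_measurable_vec_nth [measurable]:
  "(\<lambda>z :: real ^ 'k. z $ i) \<in> borel_measurable borel"
  by (intro borel_measurable_continuous_onI linear_continuous_on bounded_linear_vec_nth)

lemma borel_measurable_mult_vec [measurable]:
  "(\<lambda>z. (D :: real ^ 'k ^ 'l) *v z) \<in> borel_measurable borel"
  by (intro borel_measurable_continuous_onI linear_continuous_on matrix_vector_mul_bounded_linear)

lemma matrix_sub_ldistrib_real:
  fixes X :: "real ^ 'k ^ 'l"
  shows "X ** (Y - Z) = X ** Y - X ** Z"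
  by (simp add: matrix_matrix_mult_def vec_eq_iff right_diff_distrib sum_subtractf)

lemma matrix_inv_mult_left:
  assumes "invertible X"
  shows "matrix_inv X ** X = mat 1"
  using someI_ex[OF assms[unfolded invertible_def]] by (simp add: matrix_inv_def)

lemma matrix_add_rdistrib_real:
  fixes X Y :: "real ^ 'k ^ 'l"
  shows "(X + Y) ** Z = X ** Z + Y ** Z"
  by (simp add: matrix_matrix_mult_def vec_eq_iff distrib_right sum.distrib)

text \<open>System and filter at all times \<open>j\<close>, as the inductions require. The feedback
  law and the condition on \<open>h\<close> concern the single time \<open>k\<close> and join in at
  the end.\<close>

locale kalman_predictor = prob_space M for M :: "'a measure" +
  fixes A :: "nat \<Rightarrow> real ^ 'n ^ 'n"
    and B :: "nat \<Rightarrow> real ^ 'm ^ 'n"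
    and C :: "nat \<Rightarrow> real ^ 'n ^ 'p"
    and x w xhat :: "nat \<Rightarrow> 'a \<Rightarrow> real ^ 'n"
    and u :: "nat \<Rightarrow> 'a \<Rightarrow> real ^ 'm"
    and y v :: "nat \<Rightarrow> 'a \<Rightarrow> real ^ 'p"
    and P Q :: "nat \<Rightarrow> real ^ 'n ^ 'n"
    and R :: "nat \<Rightarrow> real ^ 'p ^ 'p"
    and K :: "nat \<Rightarrow> real ^ 'p ^ 'n"
  assumes state: "\<And>j \<omega>. \<omega> \<in> space M \<Longrightarrow> x (Suc j) \<omega> = A j *v x j \<omega> + B j *v u j \<omega> + w j \<omega>"
    and measurement: "\<And>j \<omega>. \<omega> \<in> space M \<Longrightarrow> y j \<omega> = C j *v x j \<omega> + v j \<omega>"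
    and initial_gaussian: "gaussian_vector M (x 0)"
    and w_gaussian: "\<And>j. gaussian_vector M (w j)"
    and v_gaussian: "\<And>j. gaussian_vector M (v j)"
    and w_mean: "\<And>j. (\<integral>\<omega>. w j \<omega> \<partial>M) = 0"
    and v_mean: "\<And>j. (\<integral>\<omega>. v j \<omega> \<partial>M) = 0"
    and independent: "independent_sources M (x 0) w v"
    and predictor: "\<And>j. is_vector_cond_exp M (past_outputs M y j) (x j) (xhat j)"
    and estimator: "\<And>j \<omega>. \<omega> \<in> space M \<Longrightarrow>
          xhat (Suc j) \<omega> = A j *v xhat j \<omega> + B j *v u j \<omega> + K j *v (y j \<omega> - C j *v xhat j \<omega>)"
    and Q: "\<And>j. Q j = moment M (w j) (w j)"
    and R: "\<And>j. R j = moment M (v j) (v j)"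
    and P_0: "P 0 = moment M (\<lambda>\<omega>. x 0 \<omega> - xhat 0 \<omega>) (\<lambda>\<omega>. x 0 \<omega> - xhat 0 \<omega>)"
    and P_Suc: "\<And>j. P (Suc j) = A j ** P j ** transpose (A j) + Q j
          - A j ** P j ** transpose (C j)
            ** matrix_inv (C j ** P j ** transpose (C j) + R j)
            ** C j ** P j ** transpose (A j)"
    and gain: "\<And>j. K j = A j ** P j ** transpose (C j)
            ** matrix_inv (C j ** P j ** transpose (C j) + R j)"
    and innovation_invertible: "\<And>j. invertible (C j ** P j ** transpose (C j) + R j)"
begin

definition source_algebra :: "source \<Rightarrow> 'a measure" where
  "source_algebra s = (case s of
       Initial \<Rightarrow> generated_by M (x 0)
     | Disturbance j \<Rightarrow> generated_by M (w j)
     | Noise j \<Rightarrow> generated_by M (v j))"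

text \<open>The initial state is centred by its mean; the noises already have mean zero.\<close>

definition source_functionals :: "source \<Rightarrow> ('a \<Rightarrow> real) set" where
  "source_functionals s = (case s of
       Initial \<Rightarrow> range (\<lambda>a \<omega>. a \<bullet> (x 0 \<omega> - expectation (x 0)))
     | Disturbance j \<Rightarrow> range (\<lambda>a \<omega>. a \<bullet> w j \<omega>)
     | Noise j \<Rightarrow> range (\<lambda>a \<omega>. a \<bullet> v j \<omega>))"

sublocale gaussian_sources M source_algebra source_functionals
proof
  have "(\<lambda>s. sets (source_algebra s)) = (\<lambda>s. case s of
              Initial \<Rightarrow> sets (generated_by M (x 0))
            | Disturbance j \<Rightarrow> sets (generated_by M (w j))
            | Noise j \<Rightarrow> sets (generated_by M (v j)))"
    by (auto simp: source_algebra_def fun_eq_iff split: source.split)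
  then show "indep_sets (\<lambda>s. sets (source_algebra s)) UNIV"
    using independent by (simp add: independent_sources_def)
  show "space (source_algebra s) = space M" for s
    by (simp add: source_algebra_def split: source.split)
  have functional: "(\<lambda>\<omega>. a \<bullet> (X \<omega> - c)) \<in> borel_measurable (generated_by M X)"
    for a c and X :: "'a \<Rightarrow> real ^ 'd"
    using measurable_generated_by[of X M] by simp
  show "T \<in> borel_measurable (source_algebra s)" if "T \<in> source_functionals s" for T s
    using that functional[of _ "x 0"] functional[of _ "w _" 0] functional[of _ "v _" 0]
    by (auto simp: source_algebra_def source_functionals_def split: source.splits)
  show "(\<lambda>_. 0) \<in> source_functionals s" for s
    by (auto simp: source_functionals_def split: source.split intro!: image_eqI[of _ _ 0])
  show "(\<lambda>\<omega>. T \<omega> + U \<omega>) \<in> source_functionals s"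
    if "T \<in> source_functionals s" "U \<in> source_functionals s" for T U s
    using that
    by (auto simp: source_functionals_def inner_add_left[symmetric] split: source.splits)
  show "(\<lambda>\<omega>. r * T \<omega>) \<in> source_functionals s" if "T \<in> source_functionals s" for T r s
    using that
    by (auto simp: source_functionals_def inner_scaleR_left[symmetric] simp del: inner_scaleR_left
        split: source.splits)
  show "centered_normal M T" if "T \<in> source_functionals s" for T s
    using that gaussian_vector_centered_normal[OF initial_gaussian]
      gaussian_vector_centered_normal[OF w_gaussian] gaussian_vector_centered_normal[OF v_gaussian]
    by (auto simp: source_functionals_def w_mean v_mean split: source.splits)
qed

definition error :: "nat \<Rightarrow> 'a \<Rightarrow> real ^ 'n" where
  "error j \<omega> = x j \<omega> - xhat j \<omega>"

definition innovation :: "nat \<Rightarrow> 'a \<Rightarrow> real ^ 'p" where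
  "innovation j \<omega> = C j *v error j \<omega> + v j \<omega>"

text \<open>The sources that can enter the error at time \<open>j\<close>. \<open>Noise j\<close>
  and \<open>Disturbance j\<close> are excluded, which makes both uncorrelated with
  \<open>error j\<close>.\<close>

definition sources_before :: "nat \<Rightarrow> source set" where
  "sources_before j = insert Initial (Disturbance ` {..<j} \<union> Noise ` {..<j})"

lemma finite_sources_before [simp]: "finite (sources_before j)"
  by (simp add: sources_before_def)

lemma sources_before_mono: "i \<le> j \<Longrightarrow> sources_before i \<subseteq> sources_before j"
  by (auto simp: sources_before_def)

lemma innovation_eq: "\<omega> \<in> space M \<Longrightarrow> innovation j \<omega> = y j \<omega> - C j *v xhat j \<omega>"
  by (simp add: innovation_def error_def measurement matrix_vector_mult_diff_distrib)

lemma error_Suc: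
  "\<omega> \<in> space M \<Longrightarrow> error (Suc j) \<omega> = (A j *v error j \<omega> + w j \<omega>) - K j *v innovation j \<omega>"
  by (simp add: error_def state estimator innovation_eq matrix_vector_mult_diff_distrib)

lemma xhat_Suc:
  "\<omega> \<in> space M \<Longrightarrow> xhat (Suc j) \<omega> = A j *v xhat j \<omega> + B j *v u j \<omega> + K j *v innovation j \<omega>"
  by (simp add: estimator innovation_eq)

lemma vlin_w: "vlin {Disturbance j} (w j)"
  unfolding vlin_def
  by (intro allI V_subset_lin[of _ "Disturbance j"]) (auto simp: source_functionals_def)

lemma vlin_v: "vlin {Noise j} (v j)"
  unfolding vlin_def
  by (intro allI V_subset_lin[of _ "Noise j"]) (auto simp: source_functionals_def)

lemma x_integrable: "integrable M (x j)"
  and xhat_measurable_past: "xhat j \<in> borel_measurable (past_outputs M y j)"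
  and xhat_AE: "AE \<omega> in M. xhat j \<omega> $ i = real_cond_exp M (past_outputs M y j) (\<lambda>\<omega>. x j \<omega> $ i) \<omega>"
  using predictor[of j] by (auto simp: is_vector_cond_exp_def)

lemma y_measurable: "y j \<in> borel_measurable M"
proof -
  have [measurable]: "x j \<in> borel_measurable M" "v j \<in> borel_measurable M"
    using x_integrable v_gaussian by (auto simp: gaussian_vector_def)
  have "(\<lambda>\<omega>. C j *v x j \<omega> + v j \<omega>) \<in> borel_measurable M" by measurable
  then show ?thesis by (simp add: measurement cong: measurable_cong)
qed

lemma subalgebra_past: "subalgebra M (past_outputs M y j)"
  by (intro subalgebra_past_outputs y_measurable)

sublocale past: finite_measure_subalgebra M "past_outputs M y j" for j
  by unfold_locales (rule subalgebra_past)

lemma xhat_measurable: "xhat j \<in> borel_measurable M"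
  using measurable_from_subalg[OF subalgebra_past xhat_measurable_past] .

text \<open>The \<open>\<sigma>\<close>-algebra of no outputs is trivial, so the initial estimate is constant.\<close>

lemma xhat_0:
  assumes "\<omega> \<in> space M"
  shows "xhat 0 \<omega> = expectation (x 0)"
proof -
  have "sets (past_outputs M y 0) = {{}, space M}"
    by (simp add: sets_past_outputs sigma_sets_empty_eq)
  \<comment> \<open>This preimage contains \<open>\<omega>\<close>, and in the trivial sigma-algebra
    only the whole space does.\<close>
  moreover have "xhat 0 -` {xhat 0 \<omega>} \<inter> space M \<in> sets (past_outputs M y 0)"
    using measurable_sets[OF xhat_measurable_past[of 0], of "{xhat 0 \<omega>}"] by simp
  ultimately have const: "xhat 0 \<omega>' = xhat 0 \<omega>" if "\<omega>' \<in> space M" for \<omega>'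
    using assms that by auto
  have "xhat 0 \<omega> $ i = expectation (x 0) $ i" for i
  proof -
    have int: "integrable M (\<lambda>\<omega>. x 0 \<omega> $ i)"
      using integrable_bounded_linear[OF bounded_linear_vec_nth x_integrable] .
    have "xhat 0 \<omega> $ i = (\<integral>\<omega>'. xhat 0 \<omega>' $ i \<partial>M)"
      by (subst Bochner_Integration.integral_cong[OF refl, where g = "\<lambda>_. xhat 0 \<omega> $ i"])
         (auto simp: const prob_space)
    also have "\<dots> = (\<integral>\<omega>'. real_cond_exp M (past_outputs M y 0) (\<lambda>\<omega>. x 0 \<omega> $ i) \<omega>' \<partial>M)"
      using measurable_compose[OF xhat_measurable[of 0] borel_measurable_vec_nth]
      by (intro integral_cong_AE xhat_AE) auto
    also have "\<dots> = (\<integral>\<omega>. x 0 \<omega> $ i \<partial>M)"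
      by (rule past.real_cond_exp_int(2)[OF int])
    also have "\<dots> = expectation (x 0) $ i"
      by (rule integral_bounded_linear[OF bounded_linear_vec_nth x_integrable])
    finally show ?thesis .
  qed
  then show ?thesis by (simp add: vec_eq_iff)
qed

text \<open>Stated conditionally so that it can serve inside the induction on the error.\<close>

lemma vlin_innovation_error:
  assumes "vlin (sources_before j) (error j)"
  shows "vlin (insert (Noise j) (sources_before j)) (innovation j)"
  unfolding innovation_def
  by (intro vlin_add vlin_mult vlin_mono[OF assms] vlin_mono[OF vlin_v]) auto

text \<open>The base case rests on \<open>xhat 0\<close> being the mean of \<open>x 0\<close>, so
  \<open>error 0\<close> is the centred initial state. The step uses the error recursion, from which
  the inputs have dropped out.\<close>

lemma vlin_error: "vlin (sources_before j) (error j)"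
proof (induction j)
  case 0
  have "vlin (sources_before 0) (\<lambda>\<omega>. x 0 \<omega> - expectation (x 0))"
    unfolding vlin_def
    by (intro allI V_subset_lin[of _ Initial]) (auto simp: source_functionals_def sources_before_def)
  then show ?case by (rule vlin_cong) (simp add: error_def xhat_0)
next
  case (Suc j)
  have sub: "insert (Noise j) (sources_before j) \<subseteq> sources_before (Suc j)"
    "{Disturbance j} \<subseteq> sources_before (Suc j)"
    by (auto simp: sources_before_def)
  have "vlin (sources_before (Suc j)) (\<lambda>\<omega>. (A j *v error j \<omega> + w j \<omega>) - K j *v innovation j \<omega>)"
    by (intro vlin_diff vlin_add vlin_mult vlin_mono[OF Suc] vlin_mono[OF vlin_w]
        vlin_mono[OF vlin_innovation_error[OF Suc]] sub sources_before_mono) auto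
  then show ?case by (rule vlin_cong) (rule error_Suc)
qed

lemmas vlin_innovation = vlin_innovation_error[OF vlin_error]

lemma vlin_innovation_before:
  assumes "i < j"
  shows "vlin (sources_before j) (innovation i)"
  by (rule vlin_mono[OF vlin_innovation]) (use assms in \<open>auto simp: sources_before_def\<close>)

lemma innovation_measurable: "innovation j \<in> borel_measurable M"
  using vlin_integrable[OF vlin_innovation] by auto

lemma innovation_measurable_past:
  assumes "i < j"
  shows "innovation i \<in> borel_measurable (past_outputs M y j)"
proof -
  have [measurable]: "y i \<in> borel_measurable (past_outputs M y j)"
    by (rule measurable_past_outputs[OF assms])
  have [measurable]: "xhat i \<in> borel_measurable (past_outputs M y j)"
    using assms past_outputs_mono[of i j M y]
    by (intro measurable_from_subalg[OF _ xhat_measurable_past]) (auto simp: subalgebra_def)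
  have "(\<lambda>\<omega>. y i \<omega> - C i *v xhat i \<omega>) \<in> borel_measurable (past_outputs M y j)" by measurable
  then show ?thesis
    by (subst measurable_cong[OF innovation_eq]) auto
qed

text \<open>Strong induction: \<open>y i\<close> is \<open>innovation i\<close> plus a linear image
  of \<open>xhat i\<close>, and \<open>xhat i\<close> depends only on outputs before
  \<open>i\<close>, already recovered. This transfers independence from innovations to
  outputs.\<close>

lemma past_outputs_subset_innovations:
  "sets (past_outputs M y j) \<subseteq> sets (past_outputs M innovation j)"
proof (induction j rule: less_induct)
  case (less j)
  show ?case
  proof (rule past_outputs_least)
    fix i assume "i < j"
    have [measurable]: "innovation i \<in> borel_measurable (past_outputs M innovation j)"
      by (rule measurable_past_outputs[OF \<open>i < j\<close>])
    have "sets (past_outputs M y i) \<subseteq> sets (past_outputs M innovation j)"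
      using less[OF \<open>i < j\<close>] past_outputs_mono[of i j M innovation] \<open>i < j\<close> by auto
    then have [measurable]: "xhat i \<in> borel_measurable (past_outputs M innovation j)"
      by (intro measurable_from_subalg[OF _ xhat_measurable_past]) (auto simp: subalgebra_def)
    have "(\<lambda>\<omega>. innovation i \<omega> + C i *v xhat i \<omega>) \<in> borel_measurable (past_outputs M innovation j)"
      by measurable
    then show "y i \<in> borel_measurable (past_outputs M innovation j)"
      by (rule iffD1[OF measurable_cong, rotated]) (simp add: innovation_eq)
  qed simp
qed

section \<open>Orthogonality and independence of the innovations\<close>

lemma cond_exp_error:
  "AE \<omega> in M. real_cond_exp M (past_outputs M y j) (\<lambda>\<omega>. error j \<omega> $ i) \<omega> = 0"
proof -
  have x: "integrable M (\<lambda>\<omega>. x j \<omega> $ i)"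
    using integrable_bounded_linear[OF bounded_linear_vec_nth x_integrable] .
  \<comment> \<open>The error is linear in the sources and thus integrable; with \<open>x j\<close>
    this yields integrability of \<open>xhat j\<close>, so the conditional expectation of the
    difference can be split.\<close>
  have "integrable M (\<lambda>\<omega>. error j \<omega> $ i)"
    using lin_integrable[OF vlin_component[OF vlin_error]] .
  then have "integrable M (\<lambda>\<omega>. x j \<omega> $ i - error j \<omega> $ i)" using x by simp
  then have xhat: "integrable M (\<lambda>\<omega>. xhat j \<omega> $ i)" by (simp add: error_def)
  have "(\<lambda>\<omega>. xhat j \<omega> $ i) \<in> borel_measurable (past_outputs M y j)"
    by (rule measurable_compose[OF xhat_measurable_past borel_measurable_vec_nth])
  from past.real_cond_exp_F_meas[OF xhat this] past.real_cond_exp_diff[OF x xhat, of j] xhat_AE[of j i]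
  show ?thesis by eventually_elim (simp add: error_def)
qed

text \<open>Orthogonality principle: the earlier innovation is measurable for the past outputs, so
  the error may be replaced by its conditional expectation, which is 0.\<close>

lemma moment_error_innovation:
  assumes "i < j"
  shows "moment M (error j) (innovation i) = 0"
proof -
  have "expectation (\<lambda>\<omega>. error j \<omega> $ a * innovation i \<omega> $ b) = 0" for a b
  proof -
    have g: "(\<lambda>\<omega>. innovation i \<omega> $ b) \<in> borel_measurable (past_outputs M y j)"
      by (rule measurable_compose[OF innovation_measurable_past[OF assms] borel_measurable_vec_nth])
    have e: "(\<lambda>\<omega>. error j \<omega> $ a) \<in> borel_measurable M"
      using lin_measurable[OF vlin_component[OF vlin_error]] .
    have int: "integrable M (\<lambda>\<omega>. innovation i \<omega> $ b * error j \<omega> $ a)"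
      using lin_mult_integrable[OF vlin_component[OF vlin_innovation] vlin_component[OF vlin_error]] .
    have "expectation (\<lambda>\<omega>. innovation i \<omega> $ b * error j \<omega> $ a)
        = expectation (\<lambda>\<omega>. innovation i \<omega> $ b
            * real_cond_exp M (past_outputs M y j) (\<lambda>\<omega>. error j \<omega> $ a) \<omega>)"
      using past.real_cond_exp_intg(2)[OF int g e] by simp
    also have "\<dots> = expectation (\<lambda>_. 0)"
    proof (rule integral_cong_AE)
      show "AE \<omega> in M. innovation i \<omega> $ b
            * real_cond_exp M (past_outputs M y j) (\<lambda>\<omega>. error j \<omega> $ a) \<omega> = 0"
        using cond_exp_error[of j a] by eventually_elim simp
    qed (use innovation_measurable[of i] in measurable)
    finally show ?thesis by (simp add: mult.commute)
  qed
  then show ?thesis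
    by (simp add: vec_eq_iff moment_component[OF vlin_error vlin_innovation])
qed

text \<open>The error part is orthogonal by the predictor property, the noise part because
  \<open>Noise j\<close> is not among the sources of an earlier innovation.\<close>

lemma moment_innovations:
  assumes "i < j"
  shows "moment M (innovation j) (innovation i) = 0"
proof -
  note z = vlin_innovation_before[OF assms]
  have v: "moment M (v j) (innovation i) = 0"
    by (rule moment_eq_0[OF vlin_v z]) (auto simp: sources_before_def)
  have "moment M (innovation j) (innovation i)
      = C j ** moment M (error j) (innovation i) + moment M (v j) (innovation i)"
    unfolding innovation_def[of j, abs_def]
    by (subst moment_add, (rule vlin_outer_integrable[OF vlin_mult[OF vlin_error] z]
          vlin_outer_integrable[OF vlin_v z])+)
       (simp add: moment_mult_left[OF vlin_outer_integrable[OF vlin_error z]])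
  then show ?thesis by (simp add: v moment_error_innovation[OF assms])
qed

lemma prob_Int_innovation:
  assumes "D \<in> sets (past_outputs M y k)" "E \<in> sets borel"
  shows "prob (D \<inter> (innovation k -` E \<inter> space M)) = prob D * prob (innovation k -` E \<inter> space M)"
proof (rule prob_Int_past_outputs[where z = innovation and k = k])
  fix s t
  \<comment> \<open>\<open>Suc k\<close>, since \<open>innovation k\<close> involves
    \<open>Noise k\<close>; all innovations up to time \<open>k\<close> then live in one common
    finite span.\<close>
  have Z: "(\<lambda>\<omega>. s \<bullet> innovation k \<omega>) \<in> lin (sources_before (Suc k))"
    using vlin_innovation_before[of k "Suc k"] by (simp add: vlin_def)
  have T: "(\<lambda>\<omega>. t j \<bullet> innovation j \<omega>) \<in> lin (sources_before (Suc k))" if "j < k" for j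
    using vlin_innovation_before[of j "Suc k"] that by (simp add: vlin_def)
  have "expectation (\<lambda>\<omega>. s \<bullet> innovation k \<omega> * (\<Sum>j<k. t j \<bullet> innovation j \<omega>))
      = (\<Sum>j<k. expectation (\<lambda>\<omega>. (s \<bullet> innovation k \<omega>) * (t j \<bullet> innovation j \<omega>)))"
    unfolding sum_distrib_left
    by (intro Bochner_Integration.integral_sum lin_mult_integrable[OF Z T]) auto
  also have "\<dots> = 0"
    by (intro sum.neutral)
       (simp add: inner_moment[OF vlin_innovation vlin_innovation] moment_innovations)
  finally show "(\<integral>\<omega>. iexp (s \<bullet> innovation k \<omega> + (\<Sum>j<k. t j \<bullet> innovation j \<omega>)) \<partial>M)
      = (\<integral>\<omega>. iexp (s \<bullet> innovation k \<omega>) \<partial>M) * (\<integral>\<omega>. iexp (\<Sum>j<k. t j \<bullet> innovation j \<omega>) \<partial>M)"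
    by (intro lin_iexp_product[OF Z lin_sum]) (auto intro: T)
qed (use assms past_outputs_subset_innovations[of k] innovation_measurable in auto)

lemma subalgebra_xhat: "subalgebra M (generated_by M (xhat k))"
  by (rule subalgebra_generated_by[OF xhat_measurable])

text \<open>The events of \<open>xhat k\<close> are events of the past outputs, from which the
  innovation is independent.\<close>

lemma real_cond_exp_innovation:
  assumes "f \<in> borel_measurable borel" "integrable M (\<lambda>\<omega>. f (innovation k \<omega>))"
  shows "AE \<omega> in M. real_cond_exp M (generated_by M (xhat k)) (\<lambda>\<omega>. f (innovation k \<omega>)) \<omega>
      = expectation (\<lambda>\<omega>. f (innovation k \<omega>))"
proof (rule real_cond_exp_indep[OF subalgebra_xhat innovation_measurable assms])
  fix D and E :: "(real ^ 'p) set" assume D: "D \<in> sets (generated_by M (xhat k))" and E: "E \<in> sets borel"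
  have "D \<in> sets (past_outputs M y k)"
    using D measurable_sets[OF xhat_measurable_past[of k]] by (auto simp: sets_generated_by)
  then show "prob (D \<inter> (innovation k -` E \<inter> space M)) = prob D * prob (innovation k -` E \<inter> space M)"
    using E by (rule prob_Int_innovation)
qed

section \<open>Second moments and the Riccati recursion\<close>

lemma moment_v_error: "moment M (v j) (error j) = 0"
  by (rule moment_eq_0[OF vlin_v vlin_error]) (auto simp: sources_before_def)

lemma moment_error_v: "moment M (error j) (v j) = 0"
  by (rule moment_eq_0[OF vlin_error vlin_v]) (auto simp: sources_before_def)

lemma moment_error_innovation_same:
  "moment M (error j) (innovation j) = moment M (error j) (error j) ** transpose (C j)"
proof -
  note int = vlin_outer_integrable[OF vlin_error vlin_mult[OF vlin_error]]
    vlin_outer_integrable[OF vlin_error vlin_v] vlin_outer_integrable[OF vlin_error vlin_error]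
  show ?thesis
    unfolding innovation_def[abs_def]
    by (simp add: moment_add_right int moment_mult_right moment_error_v)
qed

lemma moment_innovation:
  "moment M (innovation j) (innovation j) = C j ** moment M (error j) (error j) ** transpose (C j) + R j"
proof -
  have "moment M (innovation j) (innovation j)
      = moment M (\<lambda>\<omega>. C j *v error j \<omega> + v j \<omega>) (innovation j)"
    by (rule moment_cong) (simp_all add: innovation_def)
  also have "\<dots> = C j ** moment M (error j) (innovation j) + moment M (v j) (innovation j)"
    by (subst moment_add, (rule vlin_outer_integrable[OF vlin_mult[OF vlin_error] vlin_innovation]
          vlin_outer_integrable[OF vlin_v vlin_innovation])+)
       (simp add: moment_mult_left[OF vlin_outer_integrable[OF vlin_error vlin_innovation]])
  also have "moment M (v j) (innovation j) = R j"
  proof -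
    note int = vlin_outer_integrable[OF vlin_v vlin_mult[OF vlin_error]]
      vlin_outer_integrable[OF vlin_v vlin_v] vlin_outer_integrable[OF vlin_v vlin_error]
    show ?thesis
      unfolding innovation_def[abs_def]
      by (simp add: moment_add_right int moment_mult_right moment_v_error R)
  qed
  finally show ?thesis by (simp add: moment_error_innovation_same matrix_mul_assoc)
qed

text \<open>Identifies the Riccati solution with the true error covariance. Write the next error as
  a - K z with a = A e + w. Then E[z z^T] = S and E[a z^T] = K S, so both cross terms and the square
  all equal K S K^T up to sign, leaving E[a a^T] - K S K^T.\<close>

lemma moment_error: "moment M (error j) (error j) = P j"
proof (induction j)
  case 0
  then show ?case by (simp add: P_0 error_def[abs_def])
next
  case (Suc j)
  define S where "S = C j ** P j ** transpose (C j) + R j"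
  have "moment M (innovation j) (innovation j) = S"
    by (simp add: moment_innovation Suc S_def)
  have PT: "transpose (P j) = P j"
    using transpose_moment[OF vlin_outer_integrable[OF vlin_error vlin_error], of j j] Suc by simp
  have ST: "transpose S = S"
    using transpose_moment[OF vlin_outer_integrable[OF vlin_innovation vlin_innovation], of j j]
    by (simp add: moment_innovation Suc S_def)
  \<comment> \<open>Invertibility turns the gain formula into the normal equation.\<close>
  have KS: "K j ** S = A j ** P j ** transpose (C j)"
  proof -
    have "K j = A j ** P j ** transpose (C j) ** matrix_inv S" "invertible S"
      unfolding S_def by (rule gain innovation_invertible)+
    then show ?thesis
      by (simp add: matrix_inv_mult_left flip: matrix_mul_assoc)
  qed
  \<comment> \<open>The term subtracted by the Riccati recursion is K S K^T, by symmetry of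
    \<open>P j\<close> and \<open>S\<close>.\<close>
  have KCPA: "K j ** C j ** P j ** transpose (A j) = K j ** S ** transpose (K j)"
  proof -
    have "C j ** P j ** transpose (A j) = transpose (K j ** S)"
      by (simp add: KS matrix_transpose_mul PT matrix_mul_assoc)
    then show ?thesis by (simp add: matrix_transpose_mul ST flip: matrix_mul_assoc)
  qed
  let ?a = "\<lambda>\<omega>. A j *v error j \<omega> + w j \<omega>" and ?z = "innovation j"
  have a: "vlin (insert (Disturbance j) (sources_before j)) ?a"
    by (intro vlin_add vlin_mult vlin_mono[OF vlin_error] vlin_mono[OF vlin_w]) auto
  note z = vlin_innovation[of j]
  have we: "moment M (w j) (error j) = 0" "moment M (error j) (w j) = 0"
    by (rule moment_eq_0[OF vlin_w vlin_error] moment_eq_0[OF vlin_error vlin_w];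
        auto simp: sources_before_def)+
  have wz: "moment M (w j) ?z = 0"
    by (rule moment_eq_0[OF vlin_w z]) (auto simp: sources_before_def)
  note int = vlin_outer_integrable
  have "moment M (error (Suc j)) (error (Suc j))
      = moment M (\<lambda>\<omega>. ?a \<omega> - K j *v ?z \<omega>) (\<lambda>\<omega>. ?a \<omega> - K j *v ?z \<omega>)"
    by (rule moment_cong) (simp_all add: error_Suc)
  also have "\<dots> = (moment M ?a ?a - moment M ?a ?z ** transpose (K j))
      - (K j ** moment M ?z ?a - K j ** moment M ?z ?z ** transpose (K j))"
  proof -
    note d = vlin_diff[OF vlin_mono[OF a] vlin_mono[OF vlin_mult[OF z]]]
    have d: "vlin (sources_before (Suc j)) (\<lambda>\<omega>. ?a \<omega> - K j *v ?z \<omega>)"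
      by (rule d) (auto simp: sources_before_def)
    note kz = vlin_mult[OF z, of "K j"]
    have "moment M (\<lambda>\<omega>. ?a \<omega> - K j *v ?z \<omega>) (\<lambda>\<omega>. ?a \<omega> - K j *v ?z \<omega>)
        = moment M ?a (\<lambda>\<omega>. ?a \<omega> - K j *v ?z \<omega>) - K j ** moment M ?z (\<lambda>\<omega>. ?a \<omega> - K j *v ?z \<omega>)"
      by (simp only: moment_diff[OF int[OF a d] int[OF kz d]] moment_mult_left[OF int[OF z d]])
    also have "moment M ?a (\<lambda>\<omega>. ?a \<omega> - K j *v ?z \<omega>) = moment M ?a ?a - moment M ?a ?z ** transpose (K j)"
      by (simp only: moment_diff_right[OF int[OF a a] int[OF a kz]] moment_mult_right[OF int[OF a z]])
    also have "moment M ?z (\<lambda>\<omega>. ?a \<omega> - K j *v ?z \<omega>) = moment M ?z ?a - moment M ?z ?z ** transpose (K j)"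
      by (simp only: moment_diff_right[OF int[OF z a] int[OF z kz]] moment_mult_right[OF int[OF z z]])
    finally show ?thesis by (simp add: matrix_sub_ldistrib_real matrix_mul_assoc)
  qed
  also have "moment M ?z ?z = S" by fact
  also have az: "moment M ?a ?z = K j ** S"
    by (simp add: moment_add[OF int[OF vlin_mult[OF vlin_error] z] int[OF vlin_w z]]
        moment_mult_left[OF int[OF vlin_error z]] wz moment_error_innovation_same Suc KS matrix_mul_assoc)
  also have "moment M ?z ?a = S ** transpose (K j)"
    using transpose_moment[OF int[OF a z]] by (simp add: az matrix_transpose_mul ST)
  also have "moment M ?a ?a = A j ** P j ** transpose (A j) + Q j"
  proof -
    have ae: "moment M ?a (error j) = A j ** P j"
      by (simp add: moment_add[OF int[OF vlin_mult[OF vlin_error] vlin_error] int[OF vlin_w vlin_error]]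
          moment_mult_left[OF int[OF vlin_error vlin_error]] we Suc)
    have aw: "moment M ?a (w j) = Q j"
      by (simp add: moment_add[OF int[OF vlin_mult[OF vlin_error] vlin_w] int[OF vlin_w vlin_w]]
          moment_mult_left[OF int[OF vlin_error vlin_w]] we Q)
    show ?thesis
      by (simp only: moment_add_right[OF int[OF a vlin_mult[OF vlin_error]] int[OF a vlin_w]]
          moment_mult_right[OF int[OF a vlin_error]] ae aw)
  qed
  finally show ?case
    by (simp add: P_Suc gain[symmetric] KCPA matrix_mul_assoc)
qed

text \<open>E|D|^2 is the trace of E[D D^T]. The innovation covariance is a noise part plus an error
  part, which is the origin of the two traces in the bound.\<close>

lemma expectation_norm_gain_innovation:
  "expectation (\<lambda>\<omega>. (norm (K k *v innovation k \<omega>))\<^sup>2)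
    = trace (K k ** R k ** transpose (K k))
      + trace (K k ** C k ** P k ** transpose (C k) ** transpose (K k))"
proof -
  note z = vlin_innovation[of k] and kz = vlin_mult[OF vlin_innovation[of k], of "K k"]
  note int = vlin_outer_integrable
  have "expectation (\<lambda>\<omega>. (norm (K k *v innovation k \<omega>))\<^sup>2)
      = trace (moment M (\<lambda>\<omega>. K k *v innovation k \<omega>) (\<lambda>\<omega>. K k *v innovation k \<omega>))"
    by (rule trace_moment[OF int[OF kz kz], symmetric])
  also have "\<dots> = trace (K k ** (C k ** P k ** transpose (C k) + R k) ** transpose (K k))"
    by (simp add: moment_mult_left[OF int[OF z kz]] moment_mult_right[OF int[OF z z]]
        moment_innovation moment_error matrix_mul_assoc)
  also have "\<dots> = trace (K k ** R k ** transpose (K k))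
      + trace (K k ** C k ** P k ** transpose (C k) ** transpose (K k))"
    by (simp add: matrix_add_ldistrib matrix_add_rdistrib_real trace_add matrix_mul_assoc)
  finally show ?thesis .
qed

lemma integrable_norm_gain_innovation: "integrable M (\<lambda>\<omega>. (norm (K k *v innovation k \<omega>))\<^sup>2)"
  using integrable_bounded_linear[OF bounded_linear_trace
      vlin_outer_integrable[OF vlin_mult[OF vlin_innovation] vlin_mult[OF vlin_innovation]],
      of "K k" k "K k" k]
  by (simp add: trace_outer_product)

end

section \<open>The conditional bound\<close>

context kalman_predictor
begin

text \<open>\<open>F\<close> stands for the closed-loop prediction map. Value and gradient of
  \<open>h\<close> there are functions of \<open>xhat k\<close> and leave the conditional
  expectation; the linear term then vanishes and the quadratic one is a constant.\<close>

lemma cond_exp_lower_bound: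
  fixes F :: "real ^ 'n \<Rightarrow> real ^ 'n"
  assumes F[measurable]: "F \<in> borel_measurable borel"
    and step: "\<And>\<omega>. \<omega> \<in> space M \<Longrightarrow> xhat (Suc k) \<omega> = F (xhat k \<omega>) + K k *v innovation k \<omega>"
    and C2: "twice_continuously_differentiable h"
    and L: "L \<ge> 0" and bound: "\<And>\<xi>. spectral_norm (hessian h \<xi>) \<le> L"
  shows "AE \<omega> in M. real_cond_exp M (generated_by M (xhat k)) (\<lambda>\<omega>. h (xhat (Suc k) \<omega>)) \<omega>
      \<ge> h (F (xhat k \<omega>)) - L / 2 * expectation (\<lambda>\<omega>. (norm (K k *v innovation k \<omega>))\<^sup>2)"
proof -
  let ?G = "generated_by M (xhat k)"
  interpret G: finite_measure_subalgebra M ?G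
    by unfold_locales (rule subalgebra_xhat)
  define D where "D \<omega> = K k *v innovation k \<omega>" for \<omega>
  define a where "a \<omega> = h (F (xhat k \<omega>))" for \<omega>
  define g where "g \<omega> = gradient h (F (xhat k \<omega>))" for \<omega>
  \<comment> \<open>A cutoff measurable for \<open>xhat k\<close>; it makes \<open>a\<close> and
    \<open>g\<close> bounded by \<open>N\<close>, so every product below is integrable.\<close>
  define I where "I N \<omega> = (if \<bar>a \<omega>\<bar> + norm (g \<omega>) \<le> real N then 1 else 0 :: real)" for N \<omega>
  define E where "E = expectation (\<lambda>\<omega>. (norm (D \<omega>))\<^sup>2)"
  have [measurable]: "xhat k \<in> borel_measurable ?G" by (rule measurable_generated_by)
  have [measurable]: "h \<in> borel_measurable borel" "gradient h \<in> borel_measurable borel"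
    using C2 by (auto simp: twice_continuously_differentiable_def
        intro!: borel_measurable_continuous_onI differentiable_imp_continuous_on)
  have aG[measurable]: "a \<in> borel_measurable ?G" and gG[measurable]: "g \<in> borel_measurable ?G"
    unfolding a_def g_def by measurable
  have IG[measurable]: "I N \<in> borel_measurable ?G" for N
    unfolding I_def by measurable
  note to_M = measurable_from_subalg[OF subalgebra_xhat]
  note [measurable] = xhat_measurable innovation_measurable to_M[OF aG] to_M[OF gG] to_M[OF IG]
  have [measurable]: "D \<in> borel_measurable M" unfolding D_def by measurable
  have DD: "integrable M (\<lambda>\<omega>. (norm (D \<omega>))\<^sup>2)"
    unfolding D_def by (rule integrable_norm_gain_innovation)
  have intD: "integrable M D"
    unfolding D_def using vlin_integrable[OF vlin_mult[OF vlin_innovation]] .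
  have ED: "expectation D = 0"
    unfolding D_def using vlin_expectation[OF vlin_mult[OF vlin_innovation]] .
  have Di: "integrable M (\<lambda>\<omega>. D \<omega> $ i)" for i
    using integrable_bounded_linear[OF bounded_linear_vec_nth intD] .
  have EDi: "expectation (\<lambda>\<omega>. D \<omega> $ i) = 0" for i
    using integral_bounded_linear[OF bounded_linear_vec_nth intD, of i] ED by simp
  have taylor: "\<bar>h (xhat (Suc k) \<omega>) - a \<omega> - g \<omega> \<bullet> D \<omega>\<bar> \<le> L / 2 * (norm (D \<omega>))\<^sup>2"
    if "\<omega> \<in> space M" for \<omega>
    using quadratic_taylor_bound[OF C2 bound, of "F (xhat k \<omega>)" "D \<omega>"] step[OF that]
    by (simp add: a_def g_def D_def)
  have cD: "AE \<omega> in M. real_cond_exp M ?G (\<lambda>\<omega>. D \<omega> $ i) \<omega> = 0" for i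
    using real_cond_exp_innovation[of "\<lambda>z. (K k *v z) $ i" k] Di[of i] EDi[of i]
    by (simp add: D_def)
  have cDD: "AE \<omega> in M. real_cond_exp M ?G (\<lambda>\<omega>. (norm (D \<omega>))\<^sup>2) \<omega> = E"
    using real_cond_exp_innovation[of "\<lambda>z. (norm (K k *v z))\<^sup>2" k] DD
    by (simp add: D_def E_def)
  have main: "AE \<omega> in M. I N \<omega> * (a \<omega> - L / 2 * E)
      \<le> I N \<omega> * real_cond_exp M ?G (\<lambda>\<omega>. h (xhat (Suc k) \<omega>)) \<omega>" for N
  proof -
    have a: "\<bar>I N \<omega> * a \<omega>\<bar> \<le> real N" and g: "norm (I N \<omega> *\<^sub>R g \<omega>) \<le> real N" for \<omega>
      using norm_ge_zero[of "g \<omega>"] abs_ge_zero[of "a \<omega>"] unfolding I_def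
      by (cases "\<bar>a \<omega>\<bar> + norm (g \<omega>) \<le> real N"; simp; linarith)+
    have gi: "\<bar>I N \<omega> * g \<omega> $ i\<bar> \<le> real N" for \<omega> i
      using g[of \<omega>] component_le_norm_cart[of "I N \<omega> *\<^sub>R g \<omega>" i] by simp
    have i1: "integrable M (\<lambda>\<omega>. I N \<omega> * a \<omega>)"
      by (rule integrable_const_bound[where B = "real N"]) (use a in auto)
    have i2: "integrable M (\<lambda>\<omega>. I N \<omega> * g \<omega> $ i * D \<omega> $ i)" for i
      using integrable_mult_bounded[OF Di[of i], of "\<lambda>\<omega>. I N \<omega> * g \<omega> $ i" "real N"] gi
      by (simp add: mult.commute)
    have i3: "integrable M (\<lambda>\<omega>. I N \<omega> * (norm (D \<omega>))\<^sup>2)"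
      using integrable_mult_bounded[OF DD, of "I N" 1] by (simp add: I_def mult.commute)
    \<comment> \<open>In coordinates, since conditional expectations are taken of real functions and
      each \<open>g \<omega> $ i\<close> has to be taken out separately.\<close>
    have split: "I N \<omega> * (g \<omega> \<bullet> D \<omega>) = (\<Sum>i\<in>UNIV. I N \<omega> * g \<omega> $ i * D \<omega> $ i)" for \<omega>
      by (simp add: inner_vec_def sum_distrib_left mult.assoc)
    have iH: "integrable M (\<lambda>\<omega>. I N \<omega> * h (xhat (Suc k) \<omega>))"
    proof (rule Bochner_Integration.integrable_bound)
      show "integrable M (\<lambda>\<omega>. real N + real N * norm (D \<omega>) + L / 2 * (norm (D \<omega>))\<^sup>2)"
        using DD intD by simp
      show "AE \<omega> in M. norm (I N \<omega> * h (xhat (Suc k) \<omega>))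
          \<le> norm (real N + real N * norm (D \<omega>) + L / 2 * (norm (D \<omega>))\<^sup>2)"
      proof (rule AE_I2)
        fix \<omega> assume \<omega>: "\<omega> \<in> space M"
        show "norm (I N \<omega> * h (xhat (Suc k) \<omega>))
          \<le> norm (real N + real N * norm (D \<omega>) + L / 2 * (norm (D \<omega>))\<^sup>2)"
        proof (cases "\<bar>a \<omega>\<bar> + norm (g \<omega>) \<le> real N")
          case True
          have "\<bar>g \<omega> \<bullet> D \<omega>\<bar> \<le> real N * norm (D \<omega>)"
            by (rule order_trans[OF Cauchy_Schwarz_ineq2 mult_right_mono]) (use True in auto)
          then have "\<bar>h (xhat (Suc k) \<omega>)\<bar> \<le> real N + real N * norm (D \<omega>) + L / 2 * (norm (D \<omega>))\<^sup>2"
            using taylor[OF \<omega>] True norm_ge_zero[of "g \<omega>"] by linarith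
          then show ?thesis
            using True order_trans[OF _ abs_ge_self] by (simp only: I_def if_True mult_1 real_norm_def)
        next
          case False
          then show ?thesis by (simp add: I_def)
        qed
      qed
    qed measurable
    have iS: "integrable M (\<lambda>\<omega>. \<Sum>i\<in>UNIV. I N \<omega> * g \<omega> $ i * D \<omega> $ i)"
      using i2 by simp
    define lower where "lower \<omega> = (I N \<omega> * a \<omega> + (\<Sum>i\<in>UNIV. I N \<omega> * g \<omega> $ i * D \<omega> $ i))
        - L / 2 * (I N \<omega> * (norm (D \<omega>))\<^sup>2)" for \<omega>
    have le: "lower \<omega> \<le> I N \<omega> * h (xhat (Suc k) \<omega>)" if "\<omega> \<in> space M" for \<omega>
    proof -
      have "I N \<omega> * (a \<omega> + g \<omega> \<bullet> D \<omega> - L / 2 * (norm (D \<omega>))\<^sup>2) \<le> I N \<omega> * h (xhat (Suc k) \<omega>)"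
      proof (rule mult_left_mono)
        show "a \<omega> + g \<omega> \<bullet> D \<omega> - L / 2 * (norm (D \<omega>))\<^sup>2 \<le> h (xhat (Suc k) \<omega>)"
          using taylor[OF that] by linarith
      qed (simp add: I_def)
      then show ?thesis
        unfolding lower_def split[symmetric] by (simp add: algebra_simps)
    qed
    have mono: "AE \<omega> in M. real_cond_exp M ?G lower \<omega>
        \<le> real_cond_exp M ?G (\<lambda>\<omega>. I N \<omega> * h (xhat (Suc k) \<omega>)) \<omega>"
    proof (rule G.real_cond_exp_mono)
      show "integrable M lower" unfolding lower_def[abs_def] using i1 iS i3 by simp
    qed (use le iH in auto)
    \<comment> \<open>Only the product with the cutoff has to be integrable here, not
      \<open>h (xhat (Suc k) \<omega>)\<close> itself.\<close>
    have pull: "AE \<omega> in M. real_cond_exp M ?G (\<lambda>\<omega>. I N \<omega> * h (xhat (Suc k) \<omega>)) \<omega>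
        = I N \<omega> * real_cond_exp M ?G (\<lambda>\<omega>. h (xhat (Suc k) \<omega>)) \<omega>"
      by (rule G.real_cond_exp_mult) (use iH in measurable)
    have gD: "AE \<omega> in M. real_cond_exp M ?G (\<lambda>\<omega>. I N \<omega> * g \<omega> $ i * D \<omega> $ i) \<omega> = 0" for i
    proof -
      have "AE \<omega> in M. real_cond_exp M ?G (\<lambda>\<omega>. I N \<omega> * g \<omega> $ i * D \<omega> $ i) \<omega>
          = I N \<omega> * g \<omega> $ i * real_cond_exp M ?G (\<lambda>\<omega>. D \<omega> $ i) \<omega>"
        by (rule G.real_cond_exp_mult) (use i2 in measurable)
      then show ?thesis using cD[of i] by eventually_elim simp
    qed
    have dd: "AE \<omega> in M. real_cond_exp M ?G (\<lambda>\<omega>. I N \<omega> * (norm (D \<omega>))\<^sup>2) \<omega>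
        = I N \<omega> * real_cond_exp M ?G (\<lambda>\<omega>. (norm (D \<omega>))\<^sup>2) \<omega>"
      by (rule G.real_cond_exp_mult) (use i3 in measurable)
    have "AE \<omega> in M. \<forall>i. real_cond_exp M ?G (\<lambda>\<omega>. I N \<omega> * g \<omega> $ i * D \<omega> $ i) \<omega> = 0"
      using gD by (simp add: AE_all_countable)
    moreover have "AE \<omega> in M. real_cond_exp M ?G (\<lambda>\<omega>. I N \<omega> * a \<omega>) \<omega> = I N \<omega> * a \<omega>"
      by (rule G.real_cond_exp_F_meas[OF i1]) measurable
    moreover have "AE \<omega> in M. real_cond_exp M ?G lower \<omega>
        = real_cond_exp M ?G (\<lambda>\<omega>. I N \<omega> * a \<omega> + (\<Sum>i\<in>UNIV. I N \<omega> * g \<omega> $ i * D \<omega> $ i)) \<omega>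
          - real_cond_exp M ?G (\<lambda>\<omega>. L / 2 * (I N \<omega> * (norm (D \<omega>))\<^sup>2)) \<omega>"
      unfolding lower_def[abs_def] by (rule G.real_cond_exp_diff) (use i1 iS i3 in auto)
    moreover note G.real_cond_exp_add[OF i1 iS] G.real_cond_exp_cmult[OF i3, of "L / 2"]
      G.real_cond_exp_sum[of "\<lambda>i \<omega>. I N \<omega> * g \<omega> $ i * D \<omega> $ i" UNIV, OF i2]
      dd cDD mono pull
    ultimately show ?thesis
      by eventually_elim (simp add: algebra_simps)
  qed
  \<comment> \<open>The cutoffs are countably many, so one null set serves for all \<open>N\<close>;
    every \<open>\<omega>\<close> has some \<open>N\<close> with
    \<open>I N \<omega> = 1\<close>.\<close>
  then have "AE \<omega> in M. \<forall>N. I N \<omega> * (a \<omega> - L / 2 * E)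
      \<le> I N \<omega> * real_cond_exp M ?G (\<lambda>\<omega>. h (xhat (Suc k) \<omega>)) \<omega>"
    by (simp add: AE_all_countable)
  then show ?thesis
  proof eventually_elim
    case (elim \<omega>)
    obtain N where "\<bar>a \<omega>\<bar> + norm (g \<omega>) \<le> real N" using real_arch_simple by blast
    then have "I N \<omega> = 1" by (simp add: I_def)
    then show ?case using elim[rule_format, of N] by (simp add: a_def E_def D_def)
  qed
qed

end

theorem proposition4:
  fixes M :: "'a measure"
    and A :: "nat \<Rightarrow> real ^ 'n ^ 'n"
    and B :: "nat \<Rightarrow> real ^ 'm ^ 'n"
    and C :: "nat \<Rightarrow> real ^ 'n ^ 'p"
    and x w xhat :: "nat \<Rightarrow> 'a \<Rightarrow> real ^ 'n"
    and u :: "nat \<Rightarrow> 'a \<Rightarrow> real ^ 'm"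
    and y v :: "nat \<Rightarrow> 'a \<Rightarrow> real ^ 'p"
    and P Q :: "nat \<Rightarrow> real ^ 'n ^ 'n"
    and R :: "nat \<Rightarrow> real ^ 'p ^ 'p"
    and K :: "nat \<Rightarrow> real ^ 'p ^ 'n"
    and h :: "real ^ 'n \<Rightarrow> real"
    and \<mu> :: "real ^ 'n \<Rightarrow> real ^ 'm"
    and \<alpha> c lambda_max :: real
    and k :: nat
  assumes prob: "prob_space M"
    \<comment> \<open>the system\<close>
    and state: "\<And>j \<omega>. \<omega> \<in> space M \<Longrightarrow> x (Suc j) \<omega> = A j *v x j \<omega> + B j *v u j \<omega> + w j \<omega>"
    and measurement: "\<And>j \<omega>. \<omega> \<in> space M \<Longrightarrow> y j \<omega> = C j *v x j \<omega> + v j \<omega>"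
    and initial_gaussian: "gaussian_vector M (x 0)"
    and w_gaussian: "\<And>j. gaussian_vector M (w j)"
    and v_gaussian: "\<And>j. gaussian_vector M (v j)"
    and w_mean: "\<And>j. (\<integral>\<omega>. w j \<omega> \<partial>M) = 0"
    and v_mean: "\<And>j. (\<integral>\<omega>. v j \<omega> \<partial>M) = 0"
    and indep: "independent_sources M (x 0) w v"
    \<comment> \<open>inputs are causal; the one at time \<open>k\<close> is a function of the current estimate\<close>
    and causal: "\<And>j. u j \<in> borel_measurable (past_outputs M y j)"
    and feedback_measurable: "\<mu> \<in> borel_measurable borel"
    and feedback: "\<And>\<omega>. \<omega> \<in> space M \<Longrightarrow> u k \<omega> = \<mu> (xhat k \<omega>)"
    \<comment> \<open>the Kalman filter\<close>
    and predictor: "\<And>j. is_vector_cond_exp M (past_outputs M y j) (x j) (xhat j)"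
    and estimator: "\<And>j \<omega>. \<omega> \<in> space M \<Longrightarrow>
          xhat (Suc j) \<omega> = A j *v xhat j \<omega> + B j *v u j \<omega> + K j *v (y j \<omega> - C j *v xhat j \<omega>)"
    and Q: "\<And>j. Q j = (\<integral>\<omega>. outer_product (w j \<omega>) (w j \<omega>) \<partial>M)"
    and R: "\<And>j. R j = (\<integral>\<omega>. outer_product (v j \<omega>) (v j \<omega>) \<partial>M)"
    and P_0: "P 0 = (\<integral>\<omega>. outer_product (x 0 \<omega> - xhat 0 \<omega>) (x 0 \<omega> - xhat 0 \<omega>) \<partial>M)"
    and P_Suc: "\<And>j. P (Suc j) = A j ** P j ** transpose (A j) + Q j
          - A j ** P j ** transpose (C j)
            ** matrix_inv (C j ** P j ** transpose (C j) + R j)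
            ** C j ** P j ** transpose (A j)"
    and gain: "\<And>j. K j = A j ** P j ** transpose (C j)
            ** matrix_inv (C j ** P j ** transpose (C j) + R j)"
    and innovation_invertible: "\<And>j. invertible (C j ** P j ** transpose (C j) + R j)"
    \<comment> \<open>the function \<open>h\<close>\<close>
    and h_C2: "twice_continuously_differentiable h"
    and lambda_max_pos: "lambda_max > 0"
    and hessian_bound: "\<And>\<xi>. spectral_norm (hessian h \<xi>) \<le> lambda_max"
    and \<alpha>: "0 < \<alpha>" "\<alpha> < 1"
    and c: "c \<ge> 0"
    and barrier: "\<And>\<xi>. h (A k *v \<xi> + B k *v \<mu> \<xi>) - c \<ge> \<alpha> * h \<xi>"
  shows "\<forall>\<delta>. \<delta> \<le> c - lambda_max / 2 * trace (K k ** covariance_matrix M (v k) ** transpose (K k))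
                  - lambda_max / 2 * trace (K k ** C k ** P k ** transpose (C k) ** transpose (K k)) \<longrightarrow>
           (AE \<omega> in M. real_cond_exp M (generated_by M (xhat k)) (\<lambda>\<omega>'. h (xhat (Suc k) \<omega>')) \<omega>
              \<ge> \<alpha> * h (xhat k \<omega>) + \<delta>)"
proof (intro allI impI)
  fix \<delta> :: real
  assume \<delta>: "\<delta> \<le> c - lambda_max / 2 * trace (K k ** covariance_matrix M (v k) ** transpose (K k))
      - lambda_max / 2 * trace (K k ** C k ** P k ** transpose (C k) ** transpose (K k))"
  interpret kalman_predictor M A B C x w xhat u y v P Q R K
    by (rule kalman_predictor.intro[OF prob kalman_predictor_axioms.intro]; (unfold moment_def)?) fact+
  define F where "F \<xi> = A k *v \<xi> + B k *v \<mu> \<xi>" for \<xi>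
  \<comment> \<open>Covariance and raw second moment agree because the noise has mean zero.\<close>
  have "covariance_matrix M (v k) = R k"
    by (simp add: covariance_matrix_def v_mean assms)
  then have \<delta>_le: "\<delta> \<le> c - lambda_max / 2 * expectation (\<lambda>\<omega>. (norm (K k *v innovation k \<omega>))\<^sup>2)"
    using \<delta> by (simp add: expectation_norm_gain_innovation distrib_left)
  have "F \<in> borel_measurable borel"
    unfolding F_def using feedback_measurable by measurable
  moreover have "xhat (Suc k) \<omega> = F (xhat k \<omega>) + K k *v innovation k \<omega>" if "\<omega> \<in> space M" for \<omega>
    using xhat_Suc[OF that] feedback[OF that] by (simp add: F_def)
  ultimately have "AE \<omega> in M. real_cond_exp M (generated_by M (xhat k)) (\<lambda>\<omega>'. h (xhat (Suc k) \<omega>')) \<omega>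
      \<ge> h (F (xhat k \<omega>)) - lambda_max / 2 * expectation (\<lambda>\<omega>. (norm (K k *v innovation k \<omega>))\<^sup>2)"
    using lambda_max_pos by (intro cond_exp_lower_bound h_C2 hessian_bound) auto
  then show "AE \<omega> in M. real_cond_exp M (generated_by M (xhat k)) (\<lambda>\<omega>'. h (xhat (Suc k) \<omega>')) \<omega>
      \<ge> \<alpha> * h (xhat k \<omega>) + \<delta>"
  proof eventually_elim
    case (elim \<omega>)
    then show ?case using barrier[of "xhat k \<omega>"] \<delta>_le by (simp add: F_def)
  qed
qed

end
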